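(* Let $\mathcal{C}$ be a hereditary graph class, let $\mathcal{M}$ be a simple, polynomial-time computable decomposition functor for colored graphs in $\mathcal{C}$, with a polynomial-time computable, reversible replacement operator $R$. If the isomorphism problem for colored graphs in $\mathcal{C}$ that are prime with respect to $\mathcal{M}$ can be solved in polynomial time, then the isomorphism problem for all (colored) graphs in $\mathcal{C}$ can be solved in polynomial time.
   Context: A colored graph has a not necessarily proper vertex coloring; isomorphisms must preserve colors. A class is hereditary if closed under induced subgraphs. For a colored graph $G$, a colored module is a set $M\subseteq V(G)$ such that for every $v\in V(G)\setminus M$ and all $x,x'\in M$ of the same color, $v$ is adjacent to both or to neither. A module $M$ is non-trivial if there are distinct $x,y\in M$ such that every $v\notin M$ is adjacent to $x$ iff it is adjacent to $y$. A decomposition functor assigns to every colored graph $G$ a partition $\mathcal{M}(G)$ of a subset of $V(G)$ into colored modules, isomorphism-invariantly: for every isomorphism $\phi\colon G\to G'$, $\mathcal{M}(G')=\{\phi(M): M\in\mathcal{M}(G)\}$. $G$ is prime with respect to $\mathcal{M}$ if $\mathcal{M}(G)$ contains no non-trivial module. A replacement operator is an isomorphism-invariant map assigning to every non-trivial module $M$ of $\mathcal{M}(G)$ an induced subgraph of $G[M]$ (vertices possibly recolored) that contains, for each adjacency type occurring in $M$ (i.e. each set of vertices outside $M$ forming the neighborhood outside $M$ of some vertex of $M$), at least one vertex of $M$ of that type. Given a complete invariant $\mathcal{I}$ (a map with $\mathcal{I}(G_1)=\mathcal{I}(G_2)$ iff $G_1\cong G_2$), the quotient graph is obtained by simultaneously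 replacing each module by its replacement and recoloring each remaining vertex $v$ by the triple $(\chi(v),L,\mathcal{I}(M_v))$, where $\chi(v)$ is its color after replacement, $L$ is the list of colors of vertices of its module with the same adjacency type as $v$, and $M_v$ is the module containing $v$. $\mathcal{M}$ is simple (with respect to $R$) if for every complete invariant every quotient graph is prime. $R$ is reversible if two graphs are isomorphic iff their colored quotient graphs (with respect to $\mathcal{M}$ and $R$) are isomorphic.
   Formalization: A module equal to the whole vertex set V(G) is counted as trivial here; under the literal definition it is non-trivial when |V(G)| ≥ 2, and the claim would then put graph isomorphism in P. Invariance of R is read as R(φG, φM) = φ(R(G, M)). *)

theory Defs
  imports
    "HOL-Library.Multiset"
    "HOL-Library.Disjoint_Sets"
    "HOL-Computational_Algebra.Polynomial"
begin

section \<open>Polynomial-time computability\<close>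

text \<open>
  The machine model is N. Jones's WHILE language: imperative programs whose variables hold binary
  trees. Evaluating an expression is charged the size of the value of each of its subexpressions,
  so copying a tree costs its size, repeated doubling is not free, and the size of everything a
  program builds is bounded by the time it has used. With this charge WHILE programs and Turing
  machines simulate each other with polynomial overhead.
\<close>

datatype data = Atom | Pair data data

primrec dsize :: "data \<Rightarrow> nat" where
  "dsize Atom = 1"
| "dsize (Pair a b) = 1 + dsize a + dsize b"

primrec left :: "data \<Rightarrow> data" where
  "left Atom = Atom"
| "left (Pair a b) = a"

primrec right :: "data \<Rightarrow> data" where
  "right Atom = Atom"
| "right (Pair a b) = b"

fun enc_bool :: "bool \<Rightarrow> data" where
  "enc_bool False = Atom"
| "enc_bool True = Pair Atom Atom"

type_synonym store = "nat \<Rightarrow> data"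

datatype expr =
    Var nat
  | AtomE
  | PairE expr expr
  | LeftE expr
  | RightE expr
  | EqE expr expr

primrec eval_expr :: "expr \<Rightarrow> store \<Rightarrow> data" where
  "eval_expr (Var x) s = s x"
| "eval_expr AtomE s = Atom"
| "eval_expr (PairE e f) s = Pair (eval_expr e s) (eval_expr f s)"
| "eval_expr (LeftE e) s = left (eval_expr e s)"
| "eval_expr (RightE e) s = right (eval_expr e s)"
| "eval_expr (EqE e f) s = enc_bool (eval_expr e s = eval_expr f s)"

primrec cost :: "expr \<Rightarrow> store \<Rightarrow> nat" where
  "cost (Var x) s = dsize (s x)"
| "cost AtomE s = 1"
| "cost (PairE e f) s = cost e s + cost f s + dsize (eval_expr (PairE e f) s)"
| "cost (LeftE e) s = cost e s + dsize (eval_expr (LeftE e) s)"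
| "cost (RightE e) s = cost e s + dsize (eval_expr (RightE e) s)"
| "cost (EqE e f) s = cost e s + cost f s + dsize (eval_expr (EqE e f) s)"

datatype com =
    Skip
  | Assign nat expr
  | Seq com com
  | If expr com com
  | While expr com

text \<open>\<open>exec c s t s'\<close>: started in store \<open>s\<close>, the program \<open>c\<close> halts in store \<open>s'\<close> after time \<open>t\<close>.
  Every tree other than \<^const>\<open>Atom\<close> counts as true.\<close>

inductive exec :: "com \<Rightarrow> store \<Rightarrow> nat \<Rightarrow> store \<Rightarrow> bool" where
  Skip: "exec Skip s 1 s"
| Assign: "exec (Assign x e) s (1 + cost e s) (s(x := eval_expr e s))"
| Seq: "exec c s t s' \<Longrightarrow> exec d s' t' s'' \<Longrightarrow> exec (Seq c d) s (t + t') s''"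
| IfTrue: "eval_expr e s \<noteq> Atom \<Longrightarrow> exec c s t s' \<Longrightarrow> exec (If e c d) s (1 + cost e s + t) s'"
| IfFalse: "eval_expr e s = Atom \<Longrightarrow> exec d s t s' \<Longrightarrow> exec (If e c d) s (1 + cost e s + t) s'"
| WhileFalse: "eval_expr e s = Atom \<Longrightarrow> exec (While e c) s (1 + cost e s) s"
| WhileTrue: "eval_expr e s \<noteq> Atom \<Longrightarrow> exec c s t s' \<Longrightarrow> exec (While e c) s' t' s'' \<Longrightarrow>
    exec (While e c) s (1 + cost e s + t + t') s''"

text \<open>Variable 0 holds the input and the output; all other variables are initially \<^const>\<open>Atom\<close>.\<close>

definition runs :: "com \<Rightarrow> data \<Rightarrow> nat \<Rightarrow> data \<Rightarrow> bool" where
  "runs c inp t out \<longleftrightarrow> (\<exists>s. exec c ((\<lambda>_. Atom)(0 := inp)) t s \<and> s 0 = out)"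

text \<open>Inputs outside the domain \<open>D\<close> are unconstrained: these are promise problems.\<close>

definition poly_time_computable ::
    "('a \<Rightarrow> data) \<Rightarrow> ('b \<Rightarrow> data) \<Rightarrow> 'a set \<Rightarrow> ('a \<Rightarrow> 'b) \<Rightarrow> bool" where
  "poly_time_computable enc_in enc_out D f \<longleftrightarrow>
    (\<exists>c. \<exists>p :: nat poly. \<forall>x\<in>D. \<exists>t\<le>poly p (dsize (enc_in x)).
      runs c (enc_in x) t (enc_out (f x)))"

lemma exec_deterministic:
  "exec c s t s' \<Longrightarrow> exec c s u s'' \<Longrightarrow> t = u \<and> s' = s''"
proof (induction arbitrary: u s'' rule: exec.induct)
  case (Seq c s t s' d t' s2)
  from Seq.prems show ?case by (cases rule: exec.cases) (use Seq.IH in blast)+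
next
  case (WhileTrue e s c t s' t' s2)
  from WhileTrue.prems show ?case
    by (cases rule: exec.cases) (use WhileTrue.IH WhileTrue.hyps in blast)+
next
  case (IfTrue e s c t s' d)
  from IfTrue.prems show ?case
    by (cases rule: exec.cases) (use IfTrue.IH IfTrue.hyps in blast)+
next
  case (IfFalse e s d t s' c)
  from IfFalse.prems show ?case
    by (cases rule: exec.cases) (use IfFalse.IH IfFalse.hyps in blast)+
next
  case (WhileFalse e s c)
  from WhileFalse.prems show ?case
    by (cases rule: exec.cases) (use WhileFalse.hyps in blast)+
qed (auto elim: exec.cases)


section \<open>Encodings\<close>

text \<open>Trees are ordered lexicographically; the order only serves to list finite sets and multisets
  canonically.\<close>

instantiation data :: linorder
begin

fun less_eq_data :: "data \<Rightarrow> data \<Rightarrow> bool" where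
  "Atom \<le> b \<longleftrightarrow> True"
| "Pair a b \<le> Atom \<longleftrightarrow> False"
| "Pair a b \<le> Pair c d \<longleftrightarrow> (if a = c then b \<le> d else a \<le> c)"

definition less_data :: "data \<Rightarrow> data \<Rightarrow> bool" where
  "(x::data) < y \<longleftrightarrow> x \<le> y \<and> \<not> y \<le> x"

instance
proof
  fix x y z :: data
  have antisym: "x \<le> y \<Longrightarrow> y \<le> x \<Longrightarrow> x = y" for x y :: data
    by (induction x y rule: less_eq_data.induct) (auto split: if_splits elim: less_eq_data.elims)
  show "x < y \<longleftrightarrow> x \<le> y \<and> \<not> y \<le> x"
    by (rule less_data_def)
  show "x \<le> x"
    by (induction x) auto
  show "x \<le> y \<Longrightarrow> y \<le> x \<Longrightarrow> x = y"
    by (rule antisym)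
  show "x \<le> y \<or> y \<le> x"
    by (induction x y rule: less_eq_data.induct) (auto elim: data.exhaust)
  show "x \<le> y \<Longrightarrow> y \<le> z \<Longrightarrow> x \<le> z"
  proof (induction x arbitrary: y z)
    case (Pair a b)
    then obtain c d where y: "y = Pair c d" by (cases y) auto
    with Pair.prems obtain e f where z: "z = Pair e f" by (cases z) auto
    show ?case
      using Pair.prems Pair.IH(1)[of c e] Pair.IH(2)[of d f] antisym[of a c]
      unfolding y z by (auto split: if_splits)
  qed simp
qed

end

text \<open>Binary, least significant bit first.\<close>

fun enc_nat :: "nat \<Rightarrow> data" where
  "enc_nat n = (if n = 0 then Atom else Pair (enc_bool (odd n)) (enc_nat (n div 2)))"

declare enc_nat.simps [simp del]

definition enc_list :: "data list \<Rightarrow> data" where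
  "enc_list xs = foldr Pair xs Atom"

definition enc_set :: "('a \<Rightarrow> data) \<Rightarrow> 'a set \<Rightarrow> data" where
  "enc_set enc A = enc_list (sorted_list_of_set (enc ` A))"

definition enc_prod :: "('a \<Rightarrow> data) \<Rightarrow> ('b \<Rightarrow> data) \<Rightarrow> 'a \<times> 'b \<Rightarrow> data" where
  "enc_prod enc1 enc2 = (\<lambda>(x, y). Pair (enc1 x) (enc2 y))"

lemma inj_enc_bool: "inj enc_bool"
  by (rule injI) (auto elim: enc_bool.elims)

lemma inj_enc_nat: "inj enc_nat"
proof (rule injI)
  fix m n
  show "enc_nat m = enc_nat n \<Longrightarrow> m = n"
  proof (induction m arbitrary: n rule: less_induct)
    case (less m)
    show ?case
    proof (cases "m = 0 \<or> n = 0")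
      case True
      with less.prems show ?thesis
        by (auto simp: enc_nat.simps[of m] enc_nat.simps[of n] split: if_splits)
    next
      case False
      with less.prems have par: "odd m = odd n" and div: "enc_nat (m div 2) = enc_nat (n div 2)"
        using inj_enc_bool
        by (auto simp: enc_nat.simps[of m] enc_nat.simps[of n] inj_eq)
      from False less.IH[OF _ div] have "m div 2 = n div 2" by simp
      with par show ?thesis
        by (metis bit_eq_rec)
    qed
  qed
qed

lemma inj_enc_list: "inj enc_list"
proof (rule injI)
  fix xs ys
  show "enc_list xs = enc_list ys \<Longrightarrow> xs = ys"
  proof (induction xs arbitrary: ys)
    case Nil
    then show ?case by (cases ys) (auto simp: enc_list_def)
  next
    case (Cons x xs)
    then show ?case by (cases ys) (auto simp: enc_list_def)
  qed
qed

lemma enc_set_inject: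
  assumes "inj enc" "finite A" "finite B" "enc_set enc A = enc_set enc B"
  shows "A = B"
proof -
  from assms(4) inj_enc_list
  have "sorted_list_of_set (enc ` A) = sorted_list_of_set (enc ` B)"
    by (simp add: enc_set_def inj_eq)
  with assms(2,3) have "enc ` A = enc ` B"
    by (metis finite_imageI set_sorted_list_of_set)
  with assms(1) show ?thesis
    by (simp add: inj_image_eq_iff)
qed


section \<open>Graphs and colored graphs\<close>

record graph =
  verts :: "nat set"
  edges :: "nat set set"

text \<open>Colors are trees, so that a triple of the kind used to color quotient graphs is again a color.
  Values of \<open>color\<close> outside the vertex set are irrelevant.\<close>

record cgraph = graph +
  color :: "nat \<Rightarrow> data"

definition simple_graph :: "'z graph_scheme \<Rightarrow> bool" where
  "simple_graph G \<longleftrightarrow> finite (verts G) \<and> (\<forall>e\<in>edges G. e \<subseteq> verts G \<and> card e = 2)"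

definition adj :: "'z graph_scheme \<Rightarrow> nat \<Rightarrow> nat \<Rightarrow> bool" where
  "adj G u v \<longleftrightarrow> {u, v} \<in> edges G"

definition induced :: "'z graph_scheme \<Rightarrow> nat set \<Rightarrow> 'z graph_scheme" where
  "induced G W = G\<lparr>verts := W, edges := {e \<in> edges G. e \<subseteq> W}\<rparr>"

definition hereditary :: "graph set \<Rightarrow> bool" where
  "hereditary C \<longleftrightarrow> (\<forall>G\<in>C. \<forall>W\<subseteq>verts G. induced G W \<in> C)"

definition colored :: "graph set \<Rightarrow> cgraph set" where
  "colored C = {G. graph.truncate G \<in> C}"

definition is_iso :: "(nat \<Rightarrow> nat) \<Rightarrow> cgraph \<Rightarrow> cgraph \<Rightarrow> bool" where
  "is_iso \<phi> G H \<longleftrightarrow> bij_betw \<phi> (verts G) (verts H) \<and>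
    (\<forall>u\<in>verts G. \<forall>v\<in>verts G. adj G u v \<longleftrightarrow> adj H (\<phi> u) (\<phi> v)) \<and>
    (\<forall>v\<in>verts G. color H (\<phi> v) = color G v)"

definition isomorphic :: "cgraph \<Rightarrow> cgraph \<Rightarrow> bool" where
  "isomorphic G H \<longleftrightarrow> (\<exists>\<phi>. is_iso \<phi> G H)"

definition enc_cgraph :: "cgraph \<Rightarrow> data" where
  "enc_cgraph G = Pair (enc_set (\<lambda>v. Pair (enc_nat v) (color G v)) (verts G))
    (enc_set (enc_set enc_nat) (edges G))"

lemma isomorphic_refl: "isomorphic G G"
proof -
  have "is_iso id G G" by (simp add: is_iso_def)
  then show ?thesis by (auto simp: isomorphic_def)
qed

lemma isomorphic_sym:
  assumes "isomorphic G H"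
  shows "isomorphic H G"
proof -
  from assms obtain \<phi> where \<phi>: "is_iso \<phi> G H" by (auto simp: isomorphic_def)
  define \<psi> where "\<psi> = inv_into (verts G) \<phi>"
  from \<phi> have bij: "bij_betw \<phi> (verts G) (verts H)" by (simp add: is_iso_def)
  then have "bij_betw \<psi> (verts H) (verts G)" unfolding \<psi>_def by (rule bij_betw_inv_into)
  moreover have inv: "\<psi> v \<in> verts G \<and> \<phi> (\<psi> v) = v" if "v \<in> verts H" for v
    using that bij unfolding \<psi>_def
    by (metis bij_betw_imp_surj_on bij_betw_inv_into_right inv_into_into)
  moreover have "adj H u v \<longleftrightarrow> adj G (\<psi> u) (\<psi> v)" if "u \<in> verts H" "v \<in> verts H" for u v
    using \<phi> inv[OF that(1)] inv[OF that(2)] unfolding is_iso_def by force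
  moreover have "color G (\<psi> v) = color H v" if "v \<in> verts H" for v
    using \<phi> inv[OF that] unfolding is_iso_def by force
  ultimately have "is_iso \<psi> H G"
    unfolding is_iso_def by blast
  then show ?thesis by (auto simp: isomorphic_def)
qed

lemma isomorphic_trans:
  assumes "isomorphic G H" "isomorphic H K"
  shows "isomorphic G K"
proof -
  from assms obtain \<phi> \<psi> where *: "is_iso \<phi> G H" "is_iso \<psi> H K" by (auto simp: isomorphic_def)
  then have "bij_betw (\<psi> \<circ> \<phi>) (verts G) (verts K)"
    unfolding is_iso_def by (blast intro: bij_betw_trans)
  moreover from * have "\<phi> v \<in> verts H" if "v \<in> verts G" for v
    using that unfolding is_iso_def by (blast intro: bij_betw_apply)
  ultimately have "is_iso (\<psi> \<circ> \<phi>) G K"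
    using * by (simp add: is_iso_def)
  then show ?thesis by (auto simp: isomorphic_def)
qed

lemma enc_cgraph_isomorphic:
  assumes "simple_graph G" "simple_graph H" "enc_cgraph G = enc_cgraph H"
  shows "isomorphic G H"
proof -
  have fin: "finite (verts G)" "finite (verts H)"
    using assms by (auto simp: simple_graph_def)
  let ?eG = "\<lambda>v. Pair (enc_nat v) (color G v)" and ?eH = "\<lambda>v. Pair (enc_nat v) (color H v)"
  have "enc_set ?eG (verts G) = enc_set ?eH (verts H)"
    using assms(3) by (simp add: enc_cgraph_def)
  with inj_enc_list have "sorted_list_of_set (?eG ` verts G) = sorted_list_of_set (?eH ` verts H)"
    by (simp add: enc_set_def inj_eq)
  from arg_cong[OF this, of set] fin have im: "?eG ` verts G = ?eH ` verts H"
    by simp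
  have 1: "v \<in> verts H \<and> color H v = color G v" if "v \<in> verts G" for v
  proof -
    from that im have "?eG v \<in> ?eH ` verts H" by blast
    then obtain w where "w \<in> verts H" "enc_nat v = enc_nat w" "color G v = color H w" by auto
    with inj_enc_nat show ?thesis by (simp add: inj_eq)
  qed
  have 2: "v \<in> verts G" if "v \<in> verts H" for v
  proof -
    from that im have "?eH v \<in> ?eG ` verts G" by blast
    then obtain w where "w \<in> verts G" "enc_nat v = enc_nat w" by auto
    with inj_enc_nat show ?thesis by (simp add: inj_eq)
  qed
  have e: "sorted_list_of_set (enc_set enc_nat ` edges G) =
      sorted_list_of_set (enc_set enc_nat ` edges H)"
    using assms(3) inj_enc_list by (simp add: enc_cgraph_def enc_set_def inj_eq)
  have finE: "finite (edges K)" if "simple_graph K" for K :: cgraph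
    by (rule finite_subset[of _ "Pow (verts K)"]) (use that in \<open>auto simp: simple_graph_def\<close>)
  from arg_cong[OF e, of set] finE[OF assms(1)] finE[OF assms(2)]
  have "enc_set enc_nat ` edges G = enc_set enc_nat ` edges H"
    by simp
  moreover have finite_edge: "finite e" if "e \<in> edges G \<union> edges H" for e
  proof -
    from that assms(1,2) have "e \<subseteq> verts G \<or> e \<subseteq> verts H"
      unfolding simple_graph_def by blast
    with fin show ?thesis by (meson finite_subset)
  qed
  have "inj_on (enc_set enc_nat) (edges G \<union> edges H)"
    by (rule inj_onI, rule enc_set_inject[OF inj_enc_nat finite_edge finite_edge])
  ultimately have "edges G = edges H"
    using inj_on_image_eq_iff[of "enc_set enc_nat" "edges G \<union> edges H" "edges G" "edges H"]
    by blast
  moreover have "verts G = verts H" using 1 2 by blast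
  ultimately have "is_iso id G H"
    using 1 by (auto simp: is_iso_def adj_def)
  then show ?thesis by (auto simp: isomorphic_def)
qed

definition poly_time_isomorphism :: "cgraph set \<Rightarrow> bool" where
  "poly_time_isomorphism K \<longleftrightarrow>
    poly_time_computable (enc_prod enc_cgraph enc_cgraph) enc_bool (K \<times> K) (\<lambda>(G, H). isomorphic G H)"


section \<open>Modules, decomposition functors and replacement operators\<close>

definition colored_module :: "cgraph \<Rightarrow> nat set \<Rightarrow> bool" where
  "colored_module G A \<longleftrightarrow> A \<subseteq> verts G \<and>
    (\<forall>v\<in>verts G - A. \<forall>x\<in>A. \<forall>x'\<in>A. color G x = color G x' \<longrightarrow> (adj G v x \<longleftrightarrow> adj G v x'))"

text \<open>
  As is usual for modules, the whole vertex set counts as trivial. For \<open>A = verts G\<close> the condition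
  on \<open>x\<close> and \<open>y\<close> is vacuous; were \<open>verts G\<close> then replaced, the invariant of the module \<open>verts G\<close>
  that colors the quotient of \<open>G\<close> would be the invariant of \<open>G\<close> itself, and decomposing would not
  lead to smaller graphs.
\<close>

definition nontrivial :: "cgraph \<Rightarrow> nat set \<Rightarrow> bool" where
  "nontrivial G A \<longleftrightarrow> A \<noteq> verts G \<and>
    (\<exists>x\<in>A. \<exists>y\<in>A. x \<noteq> y \<and> (\<forall>v\<in>verts G - A. adj G v x \<longleftrightarrow> adj G v y))"

definition adj_type :: "cgraph \<Rightarrow> nat set \<Rightarrow> nat \<Rightarrow> nat set" where
  "adj_type G A x = {v \<in> verts G - A. adj G v x}"

type_synonym decomposition = "cgraph \<Rightarrow> nat set set"

definition decomposition_functor :: "graph set \<Rightarrow> decomposition \<Rightarrow> bool" where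
  "decomposition_functor C \<M> \<longleftrightarrow>
    (\<forall>G\<in>colored C. partition_on (\<Union>(\<M> G)) (\<M> G) \<and> (\<forall>A\<in>\<M> G. colored_module G A)) \<and>
    (\<forall>G\<in>colored C. \<forall>H\<in>colored C. \<forall>\<phi>. is_iso \<phi> G H \<longrightarrow> \<M> H = (\<lambda>A. \<phi> ` A) ` \<M> G)"

definition prime_wrt :: "decomposition \<Rightarrow> cgraph \<Rightarrow> bool" where
  "prime_wrt \<M> G \<longleftrightarrow> (\<forall>A\<in>\<M> G. \<not> nontrivial G A)"

type_synonym replacement = "cgraph \<Rightarrow> nat set \<Rightarrow> cgraph"

definition replacement_operator :: "graph set \<Rightarrow> decomposition \<Rightarrow> replacement \<Rightarrow> bool" where
  "replacement_operator C \<M> R \<longleftrightarrow>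
    (\<forall>G\<in>colored C. \<forall>A\<in>\<M> G. nontrivial G A \<longrightarrow>
      verts (R G A) \<subseteq> A \<and>
      edges (R G A) = edges (induced G (verts (R G A))) \<and>
      (\<forall>x\<in>A. \<exists>y\<in>verts (R G A). adj_type G A y = adj_type G A x)) \<and>
    (\<forall>G\<in>colored C. \<forall>H\<in>colored C. \<forall>\<phi>. is_iso \<phi> G H \<longrightarrow>
      (\<forall>A\<in>\<M> G. nontrivial G A \<longrightarrow> is_iso \<phi> (R G A) (R H (\<phi> ` A))))"


section \<open>Quotient graphs\<close>

definition complete_invariant :: "(cgraph \<Rightarrow> data) \<Rightarrow> bool" where
  "complete_invariant I \<longleftrightarrow>
    (\<forall>G H. simple_graph G \<longrightarrow> simple_graph H \<longrightarrow> (I G = I H \<longleftrightarrow> isomorphic G H))"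

lemma complete_invariant_exists: "\<exists>I. complete_invariant I"
proof -
  define rep where "rep G = (SOME H. simple_graph H \<and> isomorphic G H)" for G :: cgraph
  have rep: "simple_graph (rep G) \<and> isomorphic G (rep G)" if "simple_graph G" for G
    unfolding rep_def by (rule someI[of _ G]) (use that isomorphic_refl in auto)
  have "rep G = rep H" if "isomorphic G H" for G H
    unfolding rep_def
    by (rule arg_cong[where f = Eps]) (use that isomorphic_sym isomorphic_trans in blast)
  moreover have "isomorphic G H"
    if "simple_graph G" "simple_graph H" "enc_cgraph (rep G) = enc_cgraph (rep H)" for G H
    using that rep enc_cgraph_isomorphic isomorphic_sym isomorphic_trans by meson
  ultimately have "complete_invariant (\<lambda>G. enc_cgraph (rep G))"
    unfolding complete_invariant_def by metis
  then show ?thesis by blast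
qed

definition module_at :: "decomposition \<Rightarrow> cgraph \<Rightarrow> nat \<Rightarrow> nat set" where
  "module_at \<M> G v = (THE A. A \<in> \<M> G \<and> v \<in> A)"

definition quotient_verts :: "decomposition \<Rightarrow> replacement \<Rightarrow> cgraph \<Rightarrow> nat set" where
  "quotient_verts \<M> R G =
    {v \<in> verts G. \<forall>A\<in>\<M> G. nontrivial G A \<and> v \<in> A \<longrightarrow> v \<in> verts (R G A)}"

text \<open>
  The triple \<open>(\<chi>(v), L, I(M\<^sub>v))\<close>. Modules that are not replaced keep their colors in the first
  component. A vertex in no module gets the empty list and a dummy third component; this does not
  clash with the other vertices, whose list contains at least their own color in \<open>G\<close>.
\<close>

definition quotient_color ::
    "decomposition \<Rightarrow> replacement \<Rightarrow> (cgraph \<Rightarrow> data) \<Rightarrow> cgraph \<Rightarrow> nat \<Rightarrow> data" where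
  "quotient_color \<M> R I G v =
    (if v \<in> \<Union>(\<M> G) then
       let A = module_at \<M> G v;
           \<chi> = (if nontrivial G A then color (R G A) v else color G v);
           L = image_mset (color G) (mset_set {u \<in> A. adj_type G A u = adj_type G A v})
       in Pair \<chi> (Pair (enc_list (sorted_list_of_multiset L)) (I (induced G A)))
     else Pair (color G v) (Pair (enc_list []) Atom))"

definition quotient :: "decomposition \<Rightarrow> replacement \<Rightarrow> (cgraph \<Rightarrow> data) \<Rightarrow> cgraph \<Rightarrow> cgraph" where
  "quotient \<M> R I G =
    (induced G (quotient_verts \<M> R G))\<lparr>color := quotient_color \<M> R I G\<rparr>"

definition simple_wrt :: "graph set \<Rightarrow> decomposition \<Rightarrow> replacement \<Rightarrow> bool" where
  "simple_wrt C \<M> R \<longleftrightarrow>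
    (\<forall>I. complete_invariant I \<longrightarrow> (\<forall>G\<in>colored C. prime_wrt \<M> (quotient \<M> R I G)))"

definition reversible :: "graph set \<Rightarrow> decomposition \<Rightarrow> replacement \<Rightarrow> bool" where
  "reversible C \<M> R \<longleftrightarrow>
    (\<forall>I. complete_invariant I \<longrightarrow> (\<forall>G\<in>colored C. \<forall>H\<in>colored C.
      isomorphic G H \<longleftrightarrow> isomorphic (quotient \<M> R I G) (quotient \<M> R I H)))"

definition poly_time_decomposition :: "graph set \<Rightarrow> decomposition \<Rightarrow> bool" where
  "poly_time_decomposition C \<M> \<longleftrightarrow>
    poly_time_computable enc_cgraph (enc_set (enc_set enc_nat)) (colored C) \<M>"

definition poly_time_replacement :: "graph set \<Rightarrow> decomposition \<Rightarrow> replacement \<Rightarrow> bool" where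
  "poly_time_replacement C \<M> R \<longleftrightarrow>
    poly_time_computable (enc_prod enc_cgraph (enc_set enc_nat)) enc_cgraph
      {(G, A). G \<in> colored C \<and> A \<in> \<M> G \<and> nontrivial G A} (\<lambda>(G, A). R G A)"

end

theory Submission
  imports Defs
begin

text \<open>
  Only finitely many graphs matter for an input \<open>(G, H)\<close>: those obtained from \<open>G\<close> and \<open>H\<close> by
  repeatedly passing to the modules of a graph that is not prime. Since modules are disjoint and
  proper, there are polynomially many of them, and all are induced subgraphs of the input, so they
  are no larger. Going through them from the modules upwards, one maintains a table that assigns to
  each graph a representative of its isomorphism class. By reversibility two graphs that are not
  prime are compared through their quotients, which are prime by simplicity. The third components
  of the quotient colors are read off the table: sending a graph to its representative in the table
  extends to a complete invariant, and it takes values of polynomial size. Quotients are recomputed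
  whenever needed and never enter the recursion, so colors do not grow.
\<close>

section \<open>A calculus of polynomial-time computations\<close>

text \<open>Three obstacles shape the development. The given programs are correct only on promised
  inputs (\<open>\<M>\<close> on graphs of the class, \<open>R\<close> on non-trivial modules, the
  isomorphism test on prime graphs), so every rule for polynomial time carries a domain of
  instances, and conjunction, implication and branching pass a smaller domain to what they guard.
  Second, a loop whose body is polynomial need not be polynomial, since growth compounds over the
  rounds; loop rules therefore demand a bound on all reachable states in terms of the original
  input. Third, simplicity and reversibility speak about complete invariants, which are total, while
  a program knows only a finite table. Since both properties hold for every complete invariant, a
  different one may be used for each table, provided that both quotients of a comparison use the
  same one. No canonical form is available, only a yes-no test, so a class is represented by the
  first of its members that was listed.\<close>

lemma poly_nat_mono: "m \<le> n \<Longrightarrow> poly (p :: nat poly) m \<le> poly p n"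
  by (induction p) (simp_all add: mult_le_mono)

text \<open>Here \<open>x\<close> ranges over instances: from \<open>i x\<close> one has to compute \<open>j x\<close>. This form lets all
  quantities occurring in an algorithm be functions of one instance.\<close>

definition ptime :: "'x set \<Rightarrow> ('x \<Rightarrow> data) \<Rightarrow> ('x \<Rightarrow> data) \<Rightarrow> bool" where
  "ptime D i j \<longleftrightarrow> poly_time_computable i j D id"

section \<open>Frame property and clean-up of WHILE programs\<close>

primrec expr_bound :: "expr \<Rightarrow> nat" where
  "expr_bound (Var x) = Suc x"
| "expr_bound AtomE = 0"
| "expr_bound (PairE e f) = max (expr_bound e) (expr_bound f)"
| "expr_bound (LeftE e) = expr_bound e"
| "expr_bound (RightE e) = expr_bound e"
| "expr_bound (EqE e f) = max (expr_bound e) (expr_bound f)"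

primrec com_bound :: "com \<Rightarrow> nat" where
  "com_bound Skip = 0"
| "com_bound (Assign x e) = max (Suc x) (expr_bound e)"
| "com_bound (Seq c d) = max (com_bound c) (com_bound d)"
| "com_bound (If e c d) = max (expr_bound e) (max (com_bound c) (com_bound d))"
| "com_bound (While e c) = max (expr_bound e) (com_bound c)"

lemma expr_cong:
  "\<forall>v < expr_bound e. s v = r v \<Longrightarrow> eval_expr e s = eval_expr e r \<and> cost e s = cost e r"
  by (induction e) auto

text \<open>A program neither reads nor writes variables from \<open>com_bound\<close> on. Hence a
  run can be transplanted into any store that agrees below \<open>k\<close>; it takes the same time
  and leaves the rest alone.\<close>

lemma exec_frame:
  "exec c s t s' \<Longrightarrow> com_bound c \<le> k \<Longrightarrow> \<forall>v<k. r v = s v \<Longrightarrow>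
    exec c r t (\<lambda>v. if v < k then s' v else r v)"
proof (induction arbitrary: r rule: exec.induct)
  case (Skip s)
  have "(\<lambda>v. if v < k then s v else r v) = r" using Skip by auto
  then show ?case using exec.Skip[of r] by simp
next
  case (Assign x e s)
  have e: "eval_expr e r = eval_expr e s" "cost e r = cost e s"
    using expr_cong[of e r s] Assign by auto
  have "(\<lambda>v. if v < k then (s(x := eval_expr e s)) v else r v) = r(x := eval_expr e r)"
    using Assign e by auto
  then show ?case using exec.Assign[of x e r] e by simp
next
  case (Seq c s t s' d t' s'')
  let ?r = "\<lambda>v. if v < k then s' v else r v"
  have "exec c r t ?r" using Seq by simp
  moreover have "exec d ?r t' (\<lambda>v. if v < k then s'' v else ?r v)" using Seq by simp
  moreover have "(\<lambda>v. if v < k then s'' v else ?r v) = (\<lambda>v. if v < k then s'' v else r v)" by auto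
  ultimately show ?case using exec.Seq by metis
next
  case (IfTrue e s c t s' d)
  then show ?case using expr_cong[of e r s] exec.IfTrue[of e r c t _ d] by simp
next
  case (IfFalse e s d t s' c)
  then show ?case using expr_cong[of e r s] exec.IfFalse[of e r d t _ c] by simp
next
  case (WhileFalse e s c)
  have "(\<lambda>v. if v < k then s v else r v) = r" using WhileFalse by auto
  then show ?case using WhileFalse expr_cong[of e r s] exec.WhileFalse[of e r c] by simp
next
  case (WhileTrue e s c t s' t' s'')
  let ?r = "\<lambda>v. if v < k then s' v else r v"
  have "exec c r t ?r" using WhileTrue by simp
  moreover have "exec (While e c) ?r t' (\<lambda>v. if v < k then s'' v else ?r v)" using WhileTrue by simp
  moreover have "(\<lambda>v. if v < k then s'' v else ?r v) = (\<lambda>v. if v < k then s'' v else r v)" by auto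
  moreover have "eval_expr e r \<noteq> Atom" "cost e r = cost e s"
    using WhileTrue expr_cong[of e r s] by auto
  ultimately show ?case using exec.WhileTrue by metis
qed

lemma dsize_eval_le_cost: "dsize (eval_expr e s) \<le> cost e s"
  by (induction e) auto

text \<open>Only assignments enlarge a value, and the cost of an assignment already includes the
  size of the value it stores.\<close>

lemma exec_dsize_le: "exec c s t s' \<Longrightarrow> dsize (s' v) \<le> dsize (s v) + t"
proof (induction rule: exec.induct)
  case (Assign x e s)
  then show ?case using dsize_eval_le_cost[of e s] by simp
qed auto

text \<open>Variable 0 is spared because it holds the result.\<close>

primrec clear :: "nat \<Rightarrow> com" where
  "clear 0 = Skip"
| "clear (Suc k) = Seq (clear k) (Assign (Suc k) AtomE)"

lemma exec_clear: "exec (clear k) s (1 + 2 * k) (\<lambda>v. if 0 < v \<and> v \<le> k then Atom else s v)"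
proof (induction k)
  case 0
  have "(\<lambda>v. if 0 < v \<and> v \<le> 0 then Atom else s v) = s" by auto
  then show ?case using exec.Skip[of s] by simp
next
  case (Suc k)
  let ?s = "\<lambda>v. if 0 < v \<and> v \<le> k then Atom else s v"
  have "exec (Assign (Suc k) AtomE) ?s 2 (?s(Suc k := Atom))"
    using exec.Assign[of "Suc k" AtomE ?s] by (simp add: numeral_2_eq_2)
  moreover have "?s(Suc k := Atom) = (\<lambda>v. if 0 < v \<and> v \<le> Suc k then Atom else s v)"
    by (auto simp: le_Suc_eq)
  ultimately have "exec (Assign (Suc k) AtomE) ?s 2 (\<lambda>v. if 0 < v \<and> v \<le> Suc k then Atom else s v)"
    by simp
  from exec.Seq[OF Suc this] show ?case by simp
qed

text \<open>A program that cleans up after itself can be run inside any program that keeps its own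
  values in variables from \<open>k\<close> on.\<close>

definition computes ::
    "com \<Rightarrow> nat \<Rightarrow> nat poly \<Rightarrow> 'x set \<Rightarrow> ('x \<Rightarrow> data) \<Rightarrow> ('x \<Rightarrow> data) \<Rightarrow> bool" where
  "computes c k p D i j \<longleftrightarrow> (\<forall>x\<in>D. \<forall>s. s 0 = i x \<longrightarrow> (\<forall>v. 0 < v \<and> v < k \<longrightarrow> s v = Atom) \<longrightarrow>
    (\<exists>t\<le>poly p (dsize (i x)). exec c s t (s(0 := j x))))"

lemma computesD:
  assumes "computes c k p D i j" "x \<in> D" "s 0 = i x" "\<And>v. 0 < v \<Longrightarrow> v < k \<Longrightarrow> s v = Atom"
  obtains t where "t \<le> poly p (dsize (i x))" "exec c s t (s(0 := j x))"
  using assms unfolding computes_def by meson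

lemma computes_mono: "computes c k p D i j \<Longrightarrow> k \<le> k' \<Longrightarrow> computes c k' p D i j"
  unfolding computes_def by (meson less_le_trans)

text \<open>\<open>runs\<close> says nothing about the final scratch variables, so the program is
  followed by \<open>clear\<close>; the frame property then lets it start in any store that is clean
  below the bound.\<close>

lemma ptime_computes:
  assumes "ptime D i j"
  obtains c k p where "computes c k p D i j"
proof -
  from assms obtain c p where c: "\<forall>x\<in>D. \<exists>t\<le>poly p (dsize (i x)). runs c (i x) t (j x)"
    unfolding ptime_def poly_time_computable_def by auto
  \<comment> \<open>\<open>Suc\<close> keeps variable 0 below \<open>k\<close>, so that the result
    is taken over into \<open>?r\<close> even if \<open>c\<close> mentions no variable.\<close>
  define k where "k = Suc (com_bound c)"
  have "computes (Seq c (clear k)) (Suc k) (p + [:1 + 2 * k:]) D i j"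
    unfolding computes_def
  proof (intro ballI allI impI)
    fix x s assume x: "x \<in> D" "s 0 = i x" "\<forall>v. 0 < v \<and> v < Suc k \<longrightarrow> s v = Atom"
    from c x obtain t s' where t: "t \<le> poly p (dsize (i x))"
      and s': "exec c ((\<lambda>_. Atom)(0 := i x)) t s'" "s' 0 = j x"
      unfolding runs_def by blast
    let ?r = "\<lambda>v. if v < k then s' v else s v"
    have "exec c s t ?r" using x by (intro exec_frame[OF s'(1)]) (auto simp: k_def)
    from exec.Seq[OF this exec_clear[of k]]
    have "exec (Seq c (clear k)) s (t + (1 + 2 * k)) (\<lambda>v. if 0 < v \<and> v \<le> k then Atom else ?r v)" .
    moreover have "(\<lambda>v. if 0 < v \<and> v \<le> k then Atom else ?r v) = s(0 := j x)"
      using x s' by (auto simp: k_def)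
    ultimately show "\<exists>t\<le>poly (p + [:1 + 2 * k:]) (dsize (i x)). exec (Seq c (clear k)) s t (s(0 := j x))"
      using t by (intro exI[of _ "t + (1 + 2 * k)"]) simp
  qed
  then show ?thesis using that by blast
qed

lemma ptimeI:
  assumes "\<And>x. x \<in> D \<Longrightarrow>
    \<exists>t\<le>poly p (dsize (i x)). \<exists>s. exec c ((\<lambda>_. Atom)(0 := i x)) t s \<and> s 0 = j x"
  shows "ptime D i j"
  unfolding ptime_def poly_time_computable_def runs_def using assms by (metis id_apply)

text \<open>A program cannot build more than it pays for, so output sizes are polynomial too. When a
  second program is run on the result of a first, this turns its time bound into one in the original
  input.\<close>

lemma ptime_dsize:
  assumes "ptime D i j"
  obtains p where "\<And>x. x \<in> D \<Longrightarrow> dsize (j x) \<le> poly p (dsize (i x))"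
proof -
  from assms obtain c p where c: "\<forall>x\<in>D. \<exists>t\<le>poly p (dsize (i x)). runs c (i x) t (j x)"
    unfolding ptime_def poly_time_computable_def by auto
  have "dsize (j x) \<le> poly ([:0, 1:] + p) (dsize (i x))" if "x \<in> D" for x
  proof -
    from c that obtain t s where t: "t \<le> poly p (dsize (i x))"
      and s: "exec c ((\<lambda>_. Atom)(0 := i x)) t s" "s 0 = j x"
      unfolding runs_def by blast
    from exec_dsize_le[OF s(1), of 0] s t show ?thesis by simp
  qed
  then show ?thesis using that by blast
qed

section \<open>Calls, sequencing, pairing, branching and loops\<close>

lemma ptime_reindex: "ptime E i j \<Longrightarrow> (\<And>x. x \<in> D \<Longrightarrow> g x \<in> E) \<Longrightarrow> ptime D (\<lambda>x. i (g x)) (\<lambda>x. j (g x))"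
  unfolding ptime_def poly_time_computable_def by (metis id_apply)

lemma ptime_subset: "ptime E i j \<Longrightarrow> D \<subseteq> E \<Longrightarrow> ptime D i j"
  unfolding ptime_def poly_time_computable_def by (meson subset_iff)

lemma ptime_cong:
  assumes "ptime D i j" "\<And>x. x \<in> D \<Longrightarrow> i x = i' x" "\<And>x. x \<in> D \<Longrightarrow> j x = j' x"
  shows "ptime D i' j'"
  using assms unfolding ptime_def poly_time_computable_def by (metis id_apply)

lemma ptime_trans:
  assumes "ptime D i j" "ptime D j k"
  shows "ptime D i k"
proof -
  obtain c m p where c: "computes c m p D i j" using ptime_computes[OF assms(1)] .
  obtain d n q where d: "computes d n q D j k" using ptime_computes[OF assms(2)] .
  obtain r where r: "\<And>x. x \<in> D \<Longrightarrow> dsize (j x) \<le> poly r (dsize (i x))"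
    using ptime_dsize[OF assms(1)] by blast
  show ?thesis
  proof (rule ptimeI[of _ "p + pcompose q r" _ "Seq c d"])
    fix x assume x: "x \<in> D"
    obtain t where t: "t \<le> poly p (dsize (i x))"
      "exec c ((\<lambda>_. Atom)(0 := i x)) t ((\<lambda>_. Atom)(0 := i x, 0 := j x))"
      using computesD[OF c x, of "(\<lambda>_. Atom)(0 := i x)"] by auto
    obtain u where u: "u \<le> poly q (dsize (j x))"
      "exec d ((\<lambda>_. Atom)(0 := i x, 0 := j x)) u ((\<lambda>_. Atom)(0 := i x, 0 := j x, 0 := k x))"
      using computesD[OF d x, of "(\<lambda>_. Atom)(0 := i x, 0 := j x)"] by auto
    have "u \<le> poly q (poly r (dsize (i x)))" using u(1) poly_nat_mono[OF r[OF x], of q] by simp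
    then show "\<exists>t\<le>poly (p + pcompose q r) (dsize (i x)).
        \<exists>s. exec (Seq c d) ((\<lambda>_. Atom)(0 := i x)) t s \<and> s 0 = k x"
      using t exec.Seq[OF t(2) u(2)] by (intro exI[of _ "t + u"]) (auto simp: poly_pcompose)
  qed
qed

text \<open>Subroutine call: once the code of the instance \<open>g x\<close> has been computed from
  \<open>i x\<close>, the program for the other problem finishes the work. \<open>g\<close> acts on
  instances, which are mere indices; programs only ever see codes.\<close>

lemma ptime_call:
  assumes "ptime E i' j'" "ptime D i (\<lambda>x. i' (g x))" "\<And>x. x \<in> D \<Longrightarrow> g x \<in> E"
  shows "ptime D i (\<lambda>x. j' (g x))"
  using ptime_trans[OF assms(2) ptime_reindex[OF assms(1,3)]] by simp

lemma ptime_assign: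
  assumes "\<And>x. x \<in> D \<Longrightarrow> 1 + cost e ((\<lambda>_. Atom)(0 := i x)) \<le> poly p (dsize (i x))"
    and "\<And>x. x \<in> D \<Longrightarrow> eval_expr e ((\<lambda>_. Atom)(0 := i x)) = j x"
  shows "ptime D i j"
proof (rule ptimeI[of _ p _ "Assign 0 e"])
  fix x assume "x \<in> D"
  then show "\<exists>t\<le>poly p (dsize (i x)). \<exists>s. exec (Assign 0 e) ((\<lambda>_. Atom)(0 := i x)) t s \<and> s 0 = j x"
    using assms exec.Assign[of 0 e "(\<lambda>_. Atom)(0 := i x)"] by force
qed

lemma ptime_refl: "ptime D i i"
  by (rule ptime_assign[of _ "Var 0" _ "[:1, 1:]"]) auto

lemma dsize_left: "dsize (left a) \<le> dsize a" and dsize_right: "dsize (right a) \<le> dsize a"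
  by (cases a; simp)+

lemma ptime_left: "ptime D i j \<Longrightarrow> ptime D i (\<lambda>x. left (j x))"
  by (erule ptime_trans, rule ptime_assign[of _ "LeftE (Var 0)" _ "[:1, 2:]"])
    (use dsize_left in auto)

lemma ptime_right: "ptime D i j \<Longrightarrow> ptime D i (\<lambda>x. right (j x))"
  by (erule ptime_trans, rule ptime_assign[of _ "RightE (Var 0)" _ "[:1, 2:]"])
    (use dsize_right in auto)

lemma ptime_pair:
  assumes "ptime D i j" "ptime D i k"
  shows "ptime D i (\<lambda>x. Pair (j x) (k x))"
proof -
  obtain c m p where c0: "computes c m p D i j" using ptime_computes[OF assms(1)] .
  obtain d n q where d0: "computes d n q D i k" using ptime_computes[OF assms(2)] .
  \<comment> \<open>Beyond the working space of both programs: register \<open>K\<close> keeps the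
    input, which the first program overwrites, and \<open>Suc K\<close> keeps its result.\<close>
  define K where "K = Suc (max m n)"
  have c: "computes c K p D i j" and d: "computes d K q D i k"
    using c0 d0 by (auto intro: computes_mono simp: K_def)
  obtain a where a: "\<And>x. x \<in> D \<Longrightarrow> dsize (j x) \<le> poly a (dsize (i x))"
    using ptime_dsize[OF assms(1)] by blast
  obtain b where b: "\<And>x. x \<in> D \<Longrightarrow> dsize (k x) \<le> poly b (dsize (i x))"
    using ptime_dsize[OF assms(2)] by blast
  let ?prog = "Seq (Assign K (Var 0)) (Seq c (Seq (Assign (Suc K) (Var 0)) (Seq (Assign 0 (Var K))
    (Seq d (Assign 0 (PairE (Var (Suc K)) (Var 0)))))))"
  show ?thesis
  \<comment> \<open>An exact count: four assignments and the new pair node give 5, the input is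
    copied twice, \<open>j x\<close> is charged when saved, read and paired, and \<open>k x\<close>
    when read and paired.\<close>
  proof (rule ptimeI[of _ "[:5, 2:] + p + q + smult 3 a + smult 2 b" _ ?prog])
    fix x assume x: "x \<in> D"
    let ?s0 = "(\<lambda>_. Atom)(0 := i x)"
    let ?s1 = "?s0(K := i x)"
    let ?s2 = "?s1(0 := j x)"
    let ?s3 = "?s2(Suc K := j x)"
    let ?s4 = "?s3(0 := i x)"
    let ?s5 = "?s4(0 := k x)"
    let ?s6 = "?s5(0 := Pair (j x) (k x))"
    have K: "K > 0" by (simp add: K_def)
    have 1: "exec (Assign K (Var 0)) ?s0 (1 + dsize (i x)) ?s1"
      using exec.Assign[of K "Var 0" ?s0] by simp
    obtain t where t: "t \<le> poly p (dsize (i x))" and 2: "exec c ?s1 t ?s2"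
      using computesD[OF c x, of ?s1] K by auto
    have 3: "exec (Assign (Suc K) (Var 0)) ?s2 (1 + dsize (j x)) ?s3"
      using exec.Assign[of "Suc K" "Var 0" ?s2] by simp
    have 4: "exec (Assign 0 (Var K)) ?s3 (1 + dsize (i x)) ?s4"
      using exec.Assign[of 0 "Var K" ?s3] K by simp
    obtain u where u: "u \<le> poly q (dsize (i x))" and 5: "exec d ?s4 u ?s5"
      using computesD[OF d x, of ?s4] K by auto
    have 6: "exec (Assign 0 (PairE (Var (Suc K)) (Var 0))) ?s5
        (1 + (dsize (j x) + dsize (k x) + (1 + dsize (j x) + dsize (k x)))) ?s6"
      using exec.Assign[of 0 "PairE (Var (Suc K)) (Var 0)" ?s5] by simp
    note ex = exec.Seq[OF 1 exec.Seq[OF 2 exec.Seq[OF 3 exec.Seq[OF 4 exec.Seq[OF 5 6]]]]]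
    have "1 + dsize (i x) + (t + (1 + dsize (j x) + (1 + dsize (i x) + (u +
        (1 + (dsize (j x) + dsize (k x) + (1 + dsize (j x) + dsize (k x)))))))) \<le>
        poly ([:5, 2:] + p + q + smult 3 a + smult 2 b) (dsize (i x))"
      using t u a[OF x] b[OF x] by simp
    then show "\<exists>t\<le>poly ([:5, 2:] + p + q + smult 3 a + smult 2 b) (dsize (i x)).
        \<exists>s. exec ?prog ?s0 t s \<and> s 0 = Pair (j x) (k x)"
      by - (rule exI, rule conjI, assumption, rule exI, rule conjI, rule ex, simp)
  qed
qed

lemma ptime_const: "ptime D i (\<lambda>_. a)"
proof (induction a)
  case Atom
  show ?case by (rule ptime_assign[of _ AtomE _ "[:2:]"]) auto
next
  case (Pair a b)
  show ?case by (rule ptime_pair[OF Pair])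
qed

lemma dsize_enc_bool: "dsize (enc_bool b) \<le> 3"
  by (cases b) auto

lemma ptime_eq:
  assumes "ptime D i j" "ptime D i k"
  shows "ptime D i (\<lambda>x. enc_bool (j x = k x))"
proof (rule ptime_trans[OF ptime_pair[OF assms]])
  show "ptime D (\<lambda>x. Pair (j x) (k x)) (\<lambda>x. enc_bool (j x = k x))"
  proof (rule ptime_assign[of _ "EqE (LeftE (Var 0)) (RightE (Var 0))" _ "[:6, 3:]"])
    fix x
    show "1 + cost (EqE (LeftE (Var 0)) (RightE (Var 0))) ((\<lambda>_. Atom)(0 := Pair (j x) (k x)))
        \<le> poly [:6, 3:] (dsize (Pair (j x) (k x)))"
      using dsize_enc_bool[of "j x = k x"] by simp
  qed simp
qed

lemma enc_bool_eq_Atom [simp]: "enc_bool b = Atom \<longleftrightarrow> \<not> b"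
  by (cases b) auto

lemma enc_bool_inject [simp]: "enc_bool a = enc_bool b \<longleftrightarrow> a = b"
  using inj_enc_bool by (simp add: inj_eq)

text \<open>The test is computed next to a copy of the input, which the branches still need. Each
  branch has to be correct only where the test selects it, so it may call programs that guarantee
  nothing elsewhere.\<close>

lemma ptime_If:
  assumes "ptime D i (\<lambda>x. enc_bool (b x))"
    and "ptime {x \<in> D. b x} i j" "ptime {x \<in> D. \<not> b x} i k"
  shows "ptime D i (\<lambda>x. if b x then j x else k x)"
proof (rule ptime_trans[OF ptime_pair[OF assms(1) ptime_refl]])
  obtain c m p where c0: "computes c m p {x \<in> D. b x} i j" using ptime_computes[OF assms(2)] .
  obtain d n q where d0: "computes d n q {x \<in> D. \<not> b x} i k" using ptime_computes[OF assms(3)] .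
  define K where "K = Suc (max m n)"
  have c: "computes c K p {x \<in> D. b x} i j" and d: "computes d K q {x \<in> D. \<not> b x} i k"
    using c0 d0 by (auto intro: computes_mono simp: K_def)
  let ?prog = "Seq (Assign K (LeftE (Var 0))) (Seq (Assign 0 (RightE (Var 0))) (If (Var K) c d))"
  let ?in = "\<lambda>x. Pair (enc_bool (b x)) (i x)"
  show "ptime D ?in (\<lambda>x. if b x then j x else k x)"
  proof (rule ptimeI[of _ "[:20, 10:] + p + q" _ ?prog])
    fix x assume x: "x \<in> D"
    let ?s0 = "(\<lambda>_. Atom)(0 := ?in x)"
    let ?s1 = "?s0(K := enc_bool (b x))"
    let ?s2 = "?s1(0 := i x)"
    have K: "K > 0" by (simp add: K_def)
    have 1: "exec (Assign K (LeftE (Var 0))) ?s0 (1 + (dsize (?in x) + dsize (enc_bool (b x)))) ?s1"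
      using exec.Assign[of K "LeftE (Var 0)" ?s0] by simp
    have 2: "exec (Assign 0 (RightE (Var 0))) ?s1 (1 + (dsize (?in x) + dsize (i x))) ?s2"
      using exec.Assign[of 0 "RightE (Var 0)" ?s1] K by simp
    have "\<exists>t \<le> poly p (dsize (i x)) + poly q (dsize (i x)). exec (If (Var K) c d) ?s2
        (1 + dsize (enc_bool (b x)) + t) (?s2(0 := if b x then j x else k x))"
    proof (cases "b x")
      case True
      then obtain t where t: "t \<le> poly p (dsize (i x))" and "exec c ?s2 t (?s2(0 := j x))"
        using computesD[OF c, of x ?s2] K x by auto
      with exec.IfTrue[of "Var K" ?s2 c t "?s2(0 := j x)" d] show ?thesis
        using True K by (intro exI[of _ t]) auto
    next
      case False
      then obtain t where t: "t \<le> poly q (dsize (i x))" and "exec d ?s2 t (?s2(0 := k x))"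
        using computesD[OF d, of x ?s2] K x by auto
      with exec.IfFalse[of "Var K" ?s2 d t "?s2(0 := k x)" c] show ?thesis
        using False K by (intro exI[of _ t]) auto
    qed
    then obtain t where t: "t \<le> poly p (dsize (i x)) + poly q (dsize (i x))"
      and 3: "exec (If (Var K) c d) ?s2 (1 + dsize (enc_bool (b x)) + t)
        (?s2(0 := if b x then j x else k x))"
      by blast
    note ex = exec.Seq[OF 1 exec.Seq[OF 2 3]]
    have "poly p (dsize (i x)) \<le> poly p (dsize (?in x))" "poly q (dsize (i x)) \<le> poly q (dsize (?in x))"
      by (intro poly_nat_mono; simp)+
    moreover note dsize_enc_bool[of "b x"]
    ultimately have "1 + (dsize (?in x) + dsize (enc_bool (b x))) + (1 + (dsize (?in x) + dsize (i x)) +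
        (1 + dsize (enc_bool (b x)) + t)) \<le> poly ([:20, 10:] + p + q) (dsize (?in x))"
      using t by simp
    then show "\<exists>t\<le>poly ([:20, 10:] + p + q) (dsize (?in x)).
        \<exists>s. exec ?prog ?s0 t s \<and> s 0 = (if b x then j x else k x)"
      by - (rule exI, rule conjI, assumption, rule exI, rule conjI, rule ex, simp)
  qed
qed

lemma ptime_not:
  assumes "ptime D i (\<lambda>x. enc_bool (b x))"
  shows "ptime D i (\<lambda>x. enc_bool (\<not> b x))"
  using ptime_eq[OF assms ptime_const[of _ _ Atom]] by simp

text \<open>The second test is evaluated only where the first succeeded, so it may rely on
  it.\<close>

lemma ptime_conj:
  assumes "ptime D i (\<lambda>x. enc_bool (a x))" "ptime {x \<in> D. a x} i (\<lambda>x. enc_bool (b x))"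
  shows "ptime D i (\<lambda>x. enc_bool (a x \<and> b x))"
  by (rule ptime_cong[OF ptime_If[OF assms ptime_const[of _ _ "enc_bool False"]]]) simp_all

lemma ptime_imp:
  assumes "ptime D i (\<lambda>x. enc_bool (a x))" "ptime {x \<in> D. a x} i (\<lambda>x. enc_bool (b x))"
  shows "ptime D i (\<lambda>x. enc_bool (a x \<longrightarrow> b x))"
  by (rule ptime_cong[OF ptime_If[OF assms ptime_const[of _ _ "enc_bool True"]]]) simp_all

lemma ptime_iff:
  assumes "ptime D i (\<lambda>x. enc_bool (a x))" "ptime D i (\<lambda>x. enc_bool (b x))"
  shows "ptime D i (\<lambda>x. enc_bool (a x = b x))"
  using ptime_eq[OF assms] by simp

text \<open>\<open>e x s\<close> codes the loop state \<open>s\<close> of instance \<open>x\<close>,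
  and the loop runs while its left component is not \<open>Atom\<close>. \<open>S x\<close> is an
  invariant and \<open>\<mu>\<close> counts rounds. The bound \<open>q\<close> on all states of
  \<open>S x\<close> prevents polynomial growth per round from compounding.\<close>

lemma ptime_while:
  fixes S :: "'x \<Rightarrow> 's set"
  assumes init: "ptime D i (\<lambda>x. e x (start x))"
    and body: "ptime {(x, s). x \<in> D \<and> s \<in> S x \<and> left (e x s) \<noteq> Atom} (\<lambda>p. e (fst p) (snd p))
      (\<lambda>p. e (fst p) (f (fst p) (snd p)))"
    and post: "ptime {(x, s). x \<in> D \<and> s \<in> S x \<and> left (e x s) = Atom} (\<lambda>p. e (fst p) (snd p))
      (\<lambda>p. j (fst p))"
    and S0: "\<And>x. x \<in> D \<Longrightarrow> start x \<in> S x"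
    and S: "\<And>x s. x \<in> D \<Longrightarrow> s \<in> S x \<Longrightarrow> left (e x s) \<noteq> Atom \<Longrightarrow> f x s \<in> S x \<and> \<mu> x (f x s) < (\<mu> x s :: nat)"
    and size: "\<And>x s. x \<in> D \<Longrightarrow> s \<in> S x \<Longrightarrow> dsize (e x s) \<le> poly q (dsize (i x))"
    and iter: "\<And>x. x \<in> D \<Longrightarrow> \<mu> x (start x) \<le> poly r (dsize (i x))"
  shows "ptime D i j"
proof -
  let ?E = "{(x, s). x \<in> D \<and> s \<in> S x \<and> left (e x s) \<noteq> Atom}"
  let ?g = "LeftE (Var 0)"
  obtain c k p where c: "computes c k p ?E (\<lambda>p. e (fst p) (snd p)) (\<lambda>p. e (fst p) (f (fst p) (snd p)))"
    using ptime_computes[OF body] .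
  obtain a m b where a: "computes a m b D i (\<lambda>x. e x (start x))" using ptime_computes[OF init] .
  obtain d n u where d: "computes d n u {(x, s). x \<in> D \<and> s \<in> S x \<and> left (e x s) = Atom}
      (\<lambda>p. e (fst p) (snd p)) (\<lambda>p. j (fst p))" using ptime_computes[OF post] .
  \<comment> \<open>One summand per round, with \<open>Suc\<close> for the final test. A test costs
    at most twice the size of the state, because \<open>LeftE\<close> is charged for its argument
    and for its value.\<close>
  have loop: "\<exists>t s'. t \<le> Suc (\<mu> x s) * (1 + 2 * poly q (dsize (i x)) + poly p (poly q (dsize (i x)))) \<and>
      s' \<in> S x \<and> left (e x s') = Atom \<and>
      exec (While ?g c) ((\<lambda>_. Atom)(0 := e x s)) t ((\<lambda>_. Atom)(0 := e x s'))"
    if "x \<in> D" "s \<in> S x" for x s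
    using that
  proof (induction "\<mu> x s" arbitrary: s rule: less_induct)
    case less
    let ?B = "1 + 2 * poly q (dsize (i x)) + poly p (poly q (dsize (i x)))"
    let ?s = "(\<lambda>_. Atom)(0 := e x s)"
    have sz: "dsize (e x s) \<le> poly q (dsize (i x))" using size less.prems by blast
    have g: "cost ?g ?s \<le> 2 * poly q (dsize (i x))"
      using sz dsize_left[of "e x s"] by simp
    show ?case
    proof (cases "left (e x s) = Atom")
      case True
      then have "exec (While ?g c) ?s (1 + cost ?g ?s) ?s" by (intro exec.WhileFalse) simp
      then show ?thesis using True less.prems g by (intro exI[of _ "1 + cost ?g ?s"] exI[of _ s]) simp
    next
      case False
      then obtain t where t: "t \<le> poly p (dsize (e x s))" "exec c ?s t ((\<lambda>_. Atom)(0 := e x (f x s)))"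
        using computesD[OF c, of "(x, s)" ?s] less.prems by auto
      from False less.prems S have f: "f x s \<in> S x" "\<mu> x (f x s) < \<mu> x s" by blast+
      from less.hyps[OF f(2) less.prems(1) f(1)] obtain t' s'
        where t': "t' \<le> Suc (\<mu> x (f x s)) * ?B" "s' \<in> S x" "left (e x s') = Atom"
          "exec (While ?g c) ((\<lambda>_. Atom)(0 := e x (f x s))) t' ((\<lambda>_. Atom)(0 := e x s'))"
        by blast
      have "exec (While ?g c) ?s (1 + cost ?g ?s + t + t') ((\<lambda>_. Atom)(0 := e x s'))"
        using False by (intro exec.WhileTrue[OF _ t(2) t'(4)]) simp
      moreover have "1 + cost ?g ?s + t + t' \<le> Suc (\<mu> x s) * ?B"
      proof -
        have "t \<le> poly p (poly q (dsize (i x)))" using t(1) poly_nat_mono[OF sz, of p] by simp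
        then have "1 + cost ?g ?s + t + t' \<le> ?B + t'" using g by simp
        also have "\<dots> \<le> Suc (Suc (\<mu> x (f x s))) * ?B" using t'(1) by simp
        also have "\<dots> \<le> Suc (\<mu> x s) * ?B" using f(2) by (intro mult_right_mono) auto
        finally show ?thesis .
      qed
      ultimately show ?thesis using t' by blast
    qed
  qed
  show ?thesis
  proof (rule ptimeI[of _ "b + (1 + r) * (1 + smult 2 q + pcompose p q) + pcompose u q" _
        "Seq a (Seq (While ?g c) d)"])
    fix x assume x: "x \<in> D"
    let ?s = "(\<lambda>_. Atom)(0 := i x)"
    obtain t where t: "t \<le> poly b (dsize (i x))" and 1: "exec a ?s t ((\<lambda>_. Atom)(0 := e x (start x)))"
      using computesD[OF a x, of ?s] by auto
    from loop[OF x S0[OF x]] obtain t' s' where t': "s' \<in> S x" "left (e x s') = Atom"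
      "t' \<le> Suc (\<mu> x (start x)) * (1 + 2 * poly q (dsize (i x)) + poly p (poly q (dsize (i x))))"
      and 2: "exec (While ?g c) ((\<lambda>_. Atom)(0 := e x (start x))) t' ((\<lambda>_. Atom)(0 := e x s'))"
      by blast
    obtain v where v: "v \<le> poly u (dsize (e x s'))"
      and 3: "exec d ((\<lambda>_. Atom)(0 := e x s')) v ((\<lambda>_. Atom)(0 := j x))"
      using computesD[OF d, of "(x, s')" "(\<lambda>_. Atom)(0 := e x s')"] x t' by auto
    have "v \<le> poly u (poly q (dsize (i x)))"
      using v poly_nat_mono[OF size[OF x t'(1)], of u] by simp
    moreover have "t' \<le> Suc (poly r (dsize (i x))) *
        (1 + 2 * poly q (dsize (i x)) + poly p (poly q (dsize (i x))))"
      by (rule order_trans[OF t'(3)], intro mult_right_mono) (use iter[OF x] in auto)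
    ultimately have "t + (t' + v) \<le>
        poly (b + (1 + r) * (1 + smult 2 q + pcompose p q) + pcompose u q) (dsize (i x))"
      using t by (simp add: poly_pcompose)
    then show "\<exists>t\<le>poly (b + (1 + r) * (1 + smult 2 q + pcompose p q) + pcompose u q) (dsize (i x)).
        \<exists>s. exec (Seq a (Seq (While ?g c) d)) ?s t s \<and> s 0 = j x"
      using exec.Seq[OF 1 exec.Seq[OF 2 3]] by (intro exI[of _ "t + (t' + v)"]) auto
  qed
qed

section \<open>Lists\<close>

lemma enc_list_simps [simp]:
  "enc_list [] = Atom" "enc_list (x # xs) = Pair x (enc_list xs)"
  by (simp_all add: enc_list_def)

lemma enc_list_eq_Atom [simp]: "enc_list xs = Atom \<longleftrightarrow> xs = []"
  by (cases xs) auto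

lemma left_enc_list: "xs \<noteq> [] \<Longrightarrow> left (enc_list xs) = hd xs"
  by (cases xs) auto

lemma right_enc_list: "right (enc_list xs) = enc_list (tl xs)"
  by (cases xs) auto

lemma dsize_enc_list: "dsize (enc_list xs) = 1 + (\<Sum>x\<leftarrow>xs. 1 + dsize x)"
  by (induction xs) auto

lemma length_le_dsize: "length xs \<le> dsize (enc_list xs)"
  by (induction xs) auto

lemma dsize_mem_le: "a \<in> set xs \<Longrightarrow> dsize a \<le> dsize (enc_list xs)"
  by (induction xs) auto

lemma dsize_enc_list_le: "(\<And>a. a \<in> set xs \<Longrightarrow> dsize a \<le> B) \<Longrightarrow> dsize (enc_list xs) \<le> 1 + length xs * (1 + B)"
proof (induction xs)
  case (Cons a xs)
  then have "dsize (enc_list xs) \<le> 1 + length xs * (1 + B)" "dsize a \<le> B" by auto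
  then show ?case by simp
qed simp

text \<open>The body of a loop or quantifier receives the outer input paired with the current
  element; dropping that element recovers whatever could be computed outside.\<close>

lemma ptime_up:
  assumes "ptime D i j" "\<And>p. p \<in> E \<Longrightarrow> g p \<in> D"
  shows "ptime E (\<lambda>p. Pair (i (g p)) (k p)) (\<lambda>p. j (g p))"
proof -
  have "ptime E (\<lambda>p. Pair (i (g p)) (k p)) (\<lambda>p. i (g p))"
    using ptime_left[OF ptime_refl[of E "\<lambda>p. Pair (i (g p)) (k p)"]] by simp
  from ptime_call[OF assms(1) this assms(2)] show ?thesis .
qed

lemma ptime_snd: "ptime E (\<lambda>p. Pair (i p) (k p)) k"
  using ptime_right[OF ptime_refl[of E "\<lambda>p. Pair (i p) (k p)"]] by simp

lemma ptime_fst: "ptime E (\<lambda>p. Pair (i p) (k p)) i"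
  using ptime_left[OF ptime_refl[of E "\<lambda>p. Pair (i p) (k p)"]] by simp

text \<open>The body has to work only on accumulators that arise from a prefix of the list, so it
  may use whatever holds of partial results. Sizes are bounded along all prefixes, since each of
  them is a loop state.\<close>

lemma ptime_fold:
  fixes l :: "'x \<Rightarrow> 'b list" and f :: "'x \<Rightarrow> 'b \<Rightarrow> 'a \<Rightarrow> 'a"
  assumes l: "ptime D i (\<lambda>x. enc_list (map (e x) (l x)))"
    and init: "ptime D i (\<lambda>x. ea x (z x))"
    and body: "ptime {(x, b, a). x \<in> D \<and> (\<exists>us vs. l x = us @ b # vs \<and> a = fold (f x) us (z x))}
      (\<lambda>p. Pair (i (fst p)) (Pair (e (fst p) (fst (snd p))) (ea (fst p) (snd (snd p)))))
      (\<lambda>p. ea (fst p) (f (fst p) (fst (snd p)) (snd (snd p))))"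
    and size: "\<And>x us vs. x \<in> D \<Longrightarrow> l x = us @ vs \<Longrightarrow>
      dsize (ea x (fold (f x) us (z x))) \<le> poly q (dsize (i x))"
  shows "ptime D i (\<lambda>x. ea x (fold (f x) (l x) (z x)))"
proof -
  \<comment> \<open>The remaining list comes first so that its end is the exit of the loop; the
    input travels along because the body may read it.\<close>
  define es where "es x s = Pair (enc_list (map (e x) (fst s))) (Pair (i x) (ea x (snd s)))"
    for x and s :: "'b list \<times> 'a"
  define S where "S x = {(r, a). \<exists>us. l x = us @ r \<and> a = fold (f x) us (z x)}" for x
  define step where "step x s = (tl (fst s), f x (hd (fst s)) (snd s))" for x and s :: "'b list \<times> 'a"
  obtain ql where ql: "\<And>x. x \<in> D \<Longrightarrow> dsize (enc_list (map (e x) (l x))) \<le> poly ql (dsize (i x))"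
    using ptime_dsize[OF l] by blast
  show ?thesis
  proof (rule ptime_while[where e = es and start = "\<lambda>x. (l x, z x)" and S = S and f = step and
        \<mu> = "\<lambda>x s. length (fst s)" and q = "[:1, 1:] + 1 + ql + q" and r = ql])
    show "ptime D i (\<lambda>x. es x (l x, z x))"
      unfolding es_def fst_conv snd_conv by (intro ptime_pair l init ptime_refl)
    let ?E = "{(x, s). x \<in> D \<and> s \<in> S x \<and> left (es x s) \<noteq> Atom}"
    let ?i = "\<lambda>p. es (fst p) (snd p)"
    have E: "fst (snd p) \<noteq> []" if "p \<in> ?E" for p
      using that by (auto simp: es_def)
    have "ptime ?E ?i (\<lambda>p. Pair (left (right (?i p))) (Pair (left (left (?i p))) (right (right (?i p)))))"
      by (intro ptime_pair ptime_left ptime_right ptime_refl)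
    then have "ptime ?E ?i (\<lambda>p. Pair (i (fst p)) (Pair (e (fst p) (hd (fst (snd p)))) (ea (fst p) (snd (snd p)))))"
      by (rule ptime_cong) (use E in \<open>auto simp: es_def left_enc_list hd_map\<close>)
    moreover have "(fst p, hd (fst (snd p)), snd (snd p)) \<in> {(x, b, a). x \<in> D \<and>
        (\<exists>us vs. l x = us @ b # vs \<and> a = fold (f x) us (z x))}" if p: "p \<in> ?E" for p
    proof -
      obtain x r a where xra: "p = (x, r, a)" by (cases p)
      with p have x: "x \<in> D" and r: "r \<noteq> []" by (auto simp: es_def)
      from xra p obtain us where "l x = us @ r" and a: "a = fold (f x) us (z x)"
        by (auto simp: S_def)
      with r have "l x = us @ hd r # tl r" by simp
      with x a show ?thesis unfolding xra fst_conv snd_conv mem_Collect_eq prod.case by blast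
    qed
    ultimately have "ptime ?E ?i (\<lambda>p. ea (fst p) (f (fst p) (hd (fst (snd p))) (snd (snd p))))"
      using ptime_call[OF body, of ?E ?i "\<lambda>p. (fst p, hd (fst (snd p)), snd (snd p))"] by simp
    from ptime_pair[OF ptime_right[OF ptime_left[OF ptime_refl]]
        ptime_pair[OF ptime_left[OF ptime_right[OF ptime_refl]] this]]
    show "ptime ?E ?i (\<lambda>p. es (fst p) (step (fst p) (snd p)))"
      by (rule ptime_cong) (auto simp: es_def step_def right_enc_list map_tl)
    let ?F = "{(x, s). x \<in> D \<and> s \<in> S x \<and> left (es x s) = Atom}"
    have "ptime ?F ?i (\<lambda>p. right (right (?i p)))"
      by (intro ptime_right ptime_refl)
    then show "ptime ?F ?i (\<lambda>p. ea (fst p) (fold (f (fst p)) (l (fst p)) (z (fst p))))"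
      by (rule ptime_cong) (auto simp: es_def S_def)
  next
    fix x assume x: "x \<in> D"
    show "(l x, z x) \<in> S x" by (simp add: S_def)
    have "length (l x) \<le> dsize (enc_list (map (e x) (l x)))"
      using length_le_dsize[of "map (e x) (l x)"] by simp
    then show "length (fst (l x, z x)) \<le> poly ql (dsize (i x))"
      using ql[OF x] by simp
    fix s assume s: "s \<in> S x"
    then obtain us r where u: "l x = us @ r" "s = (r, fold (f x) us (z x))"
      by (auto simp: S_def)
    have "dsize (enc_list (map (e x) r)) \<le> dsize (enc_list (map (e x) (l x)))"
      using u by (simp add: dsize_enc_list)
    then show "dsize (es x s) \<le> poly ([:1, 1:] + 1 + ql + q) (dsize (i x))"
      using ql[OF x] size[OF x u(1)] u by (simp add: es_def)
    assume "left (es x s) \<noteq> Atom"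
    then obtain b vs where "r = b # vs" using u by (cases r) (auto simp: es_def)
    then show "step x s \<in> S x \<and> length (fst (step x s)) < length (fst s)"
      using u by (auto simp: S_def step_def intro!: exI[of _ "us @ [b]"])
  qed
qed

text \<open>Folding with \<open>(#)\<close> reverses, so this is the primitive from which reversal
  and then append are derived.\<close>

lemma ptime_rev_append:
  assumes "ptime D i (\<lambda>x. enc_list (xs x))" "ptime D i (\<lambda>x. enc_list (ys x))"
  shows "ptime D i (\<lambda>x. enc_list (rev (xs x) @ ys x))"
proof -
  obtain a where a: "\<And>x. x \<in> D \<Longrightarrow> dsize (enc_list (xs x)) \<le> poly a (dsize (i x))"
    using ptime_dsize[OF assms(1)] by blast
  obtain b where b: "\<And>x. x \<in> D \<Longrightarrow> dsize (enc_list (ys x)) \<le> poly b (dsize (i x))"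
    using ptime_dsize[OF assms(2)] by blast
  have fold: "fold (#) us vs = rev us @ vs" for us vs :: "data list"
    by (induction us arbitrary: vs) auto
  have "ptime D i (\<lambda>x. enc_list (fold (#) (xs x) (ys x)))"
  proof (rule ptime_fold[where e = "\<lambda>_ b. b" and q = "a + b"])
    let ?E = "{(x, b, a). x \<in> D \<and> (\<exists>us vs. xs x = us @ b # vs \<and> a = fold (#) us (ys x))}"
    show "ptime ?E (\<lambda>p. Pair (i (fst p)) (Pair (fst (snd p)) (enc_list (snd (snd p)))))
        (\<lambda>p. enc_list (fst (snd p) # snd (snd p)))"
      using ptime_snd by simp
  next
    fix x us vs assume x: "x \<in> D" "xs x = us @ vs"
    then show "dsize (enc_list (fold (#) us (ys x))) \<le> poly (a + b) (dsize (i x))"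
      using a[OF x(1)] b[OF x(1)] by (simp add: fold dsize_enc_list rev_map[symmetric])
  qed (use assms in simp_all)
  then show ?thesis by (simp add: fold)
qed

lemma ptime_rev:
  assumes "ptime D i (\<lambda>x. enc_list (xs x))"
  shows "ptime D i (\<lambda>x. enc_list (rev (xs x)))"
  using ptime_rev_append[OF assms, of "\<lambda>_. []"] ptime_const[of D i Atom] by simp

lemma ptime_append:
  assumes "ptime D i (\<lambda>x. enc_list (xs x))" "ptime D i (\<lambda>x. enc_list (ys x))"
  shows "ptime D i (\<lambda>x. enc_list (xs x @ ys x))"
  using ptime_rev_append[OF ptime_rev[OF assms(1)] assms(2)] by simp

abbreviation extend :: "('x \<Rightarrow> data) \<Rightarrow> ('x \<Rightarrow> 'b \<Rightarrow> data) \<Rightarrow> 'x \<times> 'b \<Rightarrow> data" where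
  "extend i e \<equiv> (\<lambda>p. Pair (i (fst p)) (e (fst p) (snd p)))"

text \<open>Filtering and mapping happen in one pass, so that \<open>f\<close> is computed only on
  elements that passed the test \<open>P\<close>.\<close>

lemma ptime_map_filter:
  fixes l :: "'x \<Rightarrow> 'b list"
  assumes l: "ptime D i (\<lambda>x. enc_list (map (e x) (l x)))"
    and P: "ptime (SIGMA x:D. set (l x)) (extend i e) (\<lambda>p. enc_bool (P (fst p) (snd p)))"
    and f: "ptime (SIGMA x:D. {b \<in> set (l x). P x b}) (extend i e) (\<lambda>p. f (fst p) (snd p))"
  shows "ptime D i (\<lambda>x. enc_list (map (f x) (filter (P x) (l x))))"
proof -
  define g where "g x b acc = (if P x b then f x b # acc else acc)" for x b acc
  have fold: "fold (g x) us [] = map (f x) (filter (P x) (rev us))" for x us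
    by (induction us rule: rev_induct) (auto simp: g_def)
  obtain ql where ql: "\<And>x. x \<in> D \<Longrightarrow> dsize (enc_list (map (e x) (l x))) \<le> poly ql (dsize (i x))"
    using ptime_dsize[OF l] by blast
  obtain qf where qf: "\<And>p. p \<in> (SIGMA x:D. {b \<in> set (l x). P x b}) \<Longrightarrow>
      dsize (f (fst p) (snd p)) \<le> poly qf (dsize (extend i e p))"
    using ptime_dsize[OF f] by blast
  \<comment> \<open>The list is reversed first, since consing onto the accumulator reverses it
    again. In the size bound \<open>ql\<close> limits the number of results, and \<open>qf\<close>
    is evaluated at the size of the input of the body.\<close>
  have "ptime D i (\<lambda>x. enc_list (fold (g x) (rev (l x)) []))"
  proof (rule ptime_fold[where e = e and q = "1 + ql * (1 + pcompose qf ([:1, 1:] + ql))"])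
    show "ptime D i (\<lambda>x. enc_list (map (e x) (rev (l x))))"
      using ptime_rev[OF l] by (simp add: rev_map)
    show "ptime D i (\<lambda>x. enc_list [])" using ptime_const[of D i Atom] by simp
    let ?E = "{(x, b, a). x \<in> D \<and> (\<exists>us vs. rev (l x) = us @ b # vs \<and> a = fold (g x) us [])}"
    let ?i = "\<lambda>p. Pair (i (fst p)) (Pair (e (fst p) (fst (snd p))) (enc_list (snd (snd p))))"
    have E: "(fst p, fst (snd p)) \<in> (SIGMA x:D. set (l x))" if p: "p \<in> ?E" for p
    proof -
      from p obtain us vs where "rev (l (fst p)) = us @ fst (snd p) # vs" "fst p \<in> D" by auto
      then have "fst (snd p) \<in> set (rev (l (fst p)))" by simp
      then show ?thesis using \<open>fst p \<in> D\<close> by simp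
    qed
    have 1: "ptime F ?i (\<lambda>p. Pair (i (fst p)) (e (fst p) (fst (snd p))))" for F
      using ptime_pair[OF ptime_left[OF ptime_refl[of F ?i]] ptime_left[OF ptime_right[OF ptime_refl[of F ?i]]]]
      by simp
    have 2: "ptime F ?i (\<lambda>p. enc_list (snd (snd p)))" for F
      using ptime_right[OF ptime_right[OF ptime_refl[of F ?i]]] by simp
    have b: "ptime ?E ?i (\<lambda>p. enc_bool (P (fst p) (fst (snd p))))"
      using ptime_call[OF P, of ?E ?i "\<lambda>p. (fst p, fst (snd p))"] 1 E by simp
    have "ptime {p \<in> ?E. P (fst p) (fst (snd p))} ?i (\<lambda>p. f (fst p) (fst (snd p)))"
      using ptime_call[OF f, of "{p \<in> ?E. P (fst p) (fst (snd p))}" ?i "\<lambda>p. (fst p, fst (snd p))"] 1 E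
      by simp
    from ptime_If[OF b ptime_pair[OF this 2] 2]
    show "ptime ?E ?i (\<lambda>p. enc_list (g (fst p) (fst (snd p)) (snd (snd p))))"
      by (rule ptime_cong) (auto simp: g_def)
  next
    fix x us vs assume x: "x \<in> D" "rev (l x) = us @ vs"
    then have us: "length us \<le> length (l x)" "set us \<subseteq> set (l x)"
      by (metis length_append length_rev le_add1, metis set_rev set_append Un_upper1)
    let ?B = "poly qf (1 + dsize (i x) + poly ql (dsize (i x)))"
    have "dsize (f x b) \<le> ?B" if "b \<in> set us" "P x b" for b
    proof -
      from that us have b: "(x, b) \<in> (SIGMA x:D. {b \<in> set (l x). P x b})" using x by auto
      then have "dsize (e x b) \<le> dsize (enc_list (map (e x) (l x)))"
        by (intro dsize_mem_le) auto
      then have "dsize (extend i e (x, b)) \<le> 1 + dsize (i x) + poly ql (dsize (i x))"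
        using ql[OF x(1)] by simp
      from poly_nat_mono[OF this, of qf] qf[OF b] show ?thesis by simp
    qed
    then have "dsize (enc_list (fold (g x) us [])) \<le> 1 + length (fold (g x) us []) * (1 + ?B)"
      by (intro dsize_enc_list_le) (auto simp: fold)
    also have "\<dots> \<le> 1 + poly ql (dsize (i x)) * (1 + ?B)"
    proof -
      have "length (fold (g x) us []) \<le> length us"
        using length_filter_le[of "P x" "rev us"] by (simp add: fold)
      also have "\<dots> \<le> dsize (enc_list (map (e x) (l x)))"
        using us(1) length_le_dsize[of "map (e x) (l x)"] by simp
      also have "\<dots> \<le> poly ql (dsize (i x))" by (rule ql[OF x(1)])
      finally show ?thesis by (intro add_left_mono mult_right_mono) auto
    qed
    finally show "dsize (enc_list (fold (g x) us [])) \<le>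
        poly (1 + ql * (1 + pcompose qf ([:1, 1:] + ql))) (dsize (i x))"
      by (simp add: poly_pcompose)
  qed
  then show ?thesis by (simp add: fold)
qed

lemma ptime_map:
  assumes "ptime D i (\<lambda>x. enc_list (map (e x) (l x)))"
    and "ptime (SIGMA x:D. set (l x)) (extend i e) (\<lambda>p. f (fst p) (snd p))"
  shows "ptime D i (\<lambda>x. enc_list (map (f x) (l x)))"
  using ptime_map_filter[OF assms(1), of "\<lambda>_ _. True", OF ptime_const] assms(2) by simp

lemma ptime_filter:
  assumes "ptime D i (\<lambda>x. enc_list (map (e x) (l x)))"
    and "ptime (SIGMA x:D. set (l x)) (extend i e) (\<lambda>p. enc_bool (P (fst p) (snd p)))"
  shows "ptime D i (\<lambda>x. enc_list (map (e x) (filter (P x) (l x))))"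
  using ptime_map_filter[OF assms ptime_snd] .

lemma ptime_hd:
  assumes "ptime D i (\<lambda>x. enc_list (map (e x) (l x)))" "\<And>x. x \<in> D \<Longrightarrow> l x \<noteq> []"
  shows "ptime D i (\<lambda>x. e x (hd (l x)))"
  by (rule ptime_cong[OF ptime_left[OF assms(1)]]) (use assms(2) in \<open>auto simp: left_enc_list hd_map\<close>)

text \<open>Equality of trees is a primitive test, so lexicographic comparison needs no recursion:
  it descends along a single path, to the right parts if the left parts agree and to the left parts
  otherwise.\<close>

lemma ptime_le:
  assumes "ptime D i j" "ptime D i k"
  shows "ptime D i (\<lambda>x. enc_bool (j x \<le> k x))"
proof -
  define e where "e x s = Pair (enc_bool (fst s \<noteq> Atom \<and> snd s \<noteq> Atom)) (Pair (fst s) (snd s))"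
    for x :: "'a" and s
  define S where "S x = {(a, b). (a \<le> b \<longleftrightarrow> j x \<le> k x) \<and> dsize a \<le> dsize (j x) \<and> dsize b \<le> dsize (k x)}"
    for x
  define f where "f x s = (if left (fst s) = left (snd s) then (right (fst s), right (snd s))
    else (left (fst s), left (snd s)))" for x :: "'a" and s
  obtain a where a: "\<And>x. x \<in> D \<Longrightarrow> dsize (j x) \<le> poly a (dsize (i x))"
    using ptime_dsize[OF assms(1)] by blast
  obtain b where b: "\<And>x. x \<in> D \<Longrightarrow> dsize (k x) \<le> poly b (dsize (i x))"
    using ptime_dsize[OF assms(2)] by blast
  have es: "ptime F h (\<lambda>p. e (x p) (u p, v p))" if "ptime F h u" "ptime F h v"
    for F :: "'z set" and h u v x
    unfolding e_def fst_conv snd_conv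
    by (intro ptime_pair that ptime_conj ptime_not ptime_eq ptime_const ptime_subset[OF that(2)]) auto
  show ?thesis
  proof (rule ptime_while[where e = e and start = "\<lambda>x. (j x, k x)" and S = S and f = f and
        \<mu> = "\<lambda>x s. dsize (fst s)" and q = "[:5:] + a + b" and r = a])
    show "ptime D i (\<lambda>x. e x (j x, k x))" by (rule es[OF assms])
    let ?E = "{(x, s). x \<in> D \<and> s \<in> S x \<and> left (e x s) \<noteq> Atom}"
    let ?i = "\<lambda>p. e (fst p) (snd p)"
    have fs: "ptime F ?i (\<lambda>p. fst (snd p))" and sn: "ptime F ?i (\<lambda>p. snd (snd p))" for F
      using ptime_left[OF ptime_right[OF ptime_refl[of F ?i]]]
        ptime_right[OF ptime_right[OF ptime_refl[of F ?i]]] by (simp_all add: e_def)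
    have "ptime ?E ?i (\<lambda>p. if left (fst (snd p)) = left (snd (snd p))
        then e (fst p) (right (fst (snd p)), right (snd (snd p)))
        else e (fst p) (left (fst (snd p)), left (snd (snd p))))"
      by (intro ptime_If es ptime_left ptime_right ptime_eq fs sn)
    then show "ptime ?E ?i (\<lambda>p. e (fst p) (f (fst p) (snd p)))"
      by (rule ptime_cong) (auto simp: f_def)
    let ?F = "{(x, s). x \<in> D \<and> s \<in> S x \<and> left (e x s) = Atom}"
    have "ptime ?F ?i (\<lambda>p. enc_bool (fst (snd p) = Atom))"
      by (intro ptime_eq fs ptime_const)
    then show "ptime ?F ?i (\<lambda>p. enc_bool (j (fst p) \<le> k (fst p)))"
    proof (rule ptime_cong)
      \<comment> \<open>On exit one of the trees is \<open>Atom\<close>, and then the order depends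
        only on whether the first one is.\<close>
      fix p assume "p \<in> ?F"
      then show "enc_bool (fst (snd p) = Atom) = enc_bool (j (fst p) \<le> k (fst p))"
        by (cases "fst (snd p)"; cases "snd (snd p)") (auto simp: S_def e_def)
    qed simp
  next
    fix x assume x: "x \<in> D"
    show "(j x, k x) \<in> S x" by (simp add: S_def)
    show "dsize (fst (j x, k x)) \<le> poly a (dsize (i x))" using a[OF x] by simp
    fix s assume s: "s \<in> S x"
    show "dsize (e x s) \<le> poly ([:5:] + a + b) (dsize (i x))"
      using s a[OF x] b[OF x] dsize_enc_bool[of "fst s \<noteq> Atom \<and> snd s \<noteq> Atom"]
      by (simp add: S_def e_def case_prod_beta)
    assume "left (e x s) \<noteq> Atom"
    then obtain u v u' v' where "s = (Pair u v, Pair u' v')"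
      by (cases s; cases "fst s"; cases "snd s") (auto simp: e_def)
    then show "f x s \<in> S x \<and> dsize (fst (f x s)) < dsize (fst s)"
      using s by (auto simp: f_def S_def)
  qed
qed

lemma ptime_less:
  assumes "ptime D i j" "ptime D i k"
  shows "ptime D i (\<lambda>x. enc_bool (j x < k x))"
  using ptime_not[OF ptime_le[OF assms(2,1)]] by (simp add: not_le)

lemma ptime_sort:
  assumes "ptime D i (\<lambda>x. enc_list (l x))"
  shows "ptime D i (\<lambda>x. enc_list (sort (l x)))"
proof -
  \<comment> \<open>Insertion sort, with two filters in place of an inner loop: on a sorted
    accumulator they split it at the position of \<open>b\<close>.\<close>
  define f where "f b acc = filter (\<lambda>y. y < b) acc @ b # filter (\<lambda>y. \<not> y < b) acc" for b :: data and acc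
  have mset: "mset (fold f us vs) = mset us + mset vs" for us vs
    by (induction us arbitrary: vs) (auto simp: f_def)
  have "sorted acc \<Longrightarrow> sorted (f b acc)" for b acc
    by (auto simp: f_def sorted_append intro: sorted_wrt_filter)
  then have sorted: "sorted vs \<Longrightarrow> sorted (fold f us vs)" for us vs
    by (induction us arbitrary: vs) auto
  have sort: "fold f us [] = sort us" for us
    using sorted[of "[]" us] mset[of us "[]"] properties_for_sort[of "fold f us []" us] by simp
  obtain q where q: "\<And>x. x \<in> D \<Longrightarrow> dsize (enc_list (l x)) \<le> poly q (dsize (i x))"
    using ptime_dsize[OF assms] by blast
  have "ptime D i (\<lambda>x. enc_list (fold f (l x) []))"
  proof (rule ptime_fold[where e = "\<lambda>_ b. b" and q = q])
    let ?E = "{(x, b, a). x \<in> D \<and> (\<exists>us vs. l x = us @ b # vs \<and> a = fold f us [])}"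
    let ?i = "\<lambda>p. Pair (i (fst p)) (Pair (fst (snd p)) (enc_list (snd (snd p))))"
    have b: "ptime ?E ?i (\<lambda>p. fst (snd p))" and acc: "ptime ?E ?i (\<lambda>p. enc_list (map (\<lambda>b. b) (snd (snd p))))"
      using ptime_left[OF ptime_right[OF ptime_refl[of ?E ?i]]]
        ptime_right[OF ptime_right[OF ptime_refl[of ?E ?i]]] by simp_all
    let ?G = "SIGMA p:?E. set (snd (snd p))"
    have less: "ptime ?G (extend ?i (\<lambda>p b. b)) (\<lambda>p. enc_bool (snd p < fst (snd (fst p))))"
      by (rule ptime_less[OF ptime_snd ptime_up[OF b]]) (erule SigmaE, simp only: fst_conv)
    have "ptime ?E ?i (\<lambda>p. enc_list (filter (\<lambda>y. y < fst (snd p)) (snd (snd p))))"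
      using ptime_filter[OF acc, of "\<lambda>p y. y < fst (snd p)"] less by simp
    moreover have "ptime ?E ?i (\<lambda>p. enc_list (filter (\<lambda>y. \<not> y < fst (snd p)) (snd (snd p))))"
      using ptime_filter[OF acc, of "\<lambda>p y. \<not> y < fst (snd p)"] ptime_not[OF less] by simp
    ultimately have "ptime ?E ?i (\<lambda>p. enc_list (filter (\<lambda>y. y < fst (snd p)) (snd (snd p)) @
        fst (snd p) # filter (\<lambda>y. \<not> y < fst (snd p)) (snd (snd p))))"
      using ptime_pair[OF b, of "\<lambda>p. enc_list (filter (\<lambda>y. \<not> y < fst (snd p)) (snd (snd p)))"]
      by (intro ptime_append) simp_all
    then show "ptime ?E ?i (\<lambda>p. enc_list (f (fst (snd p)) (snd (snd p))))"
      by (simp add: f_def)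
  next
    fix x us vs assume x: "x \<in> D" "l x = us @ vs"
    \<comment> \<open>Rearranging a list does not change the size of its code.\<close>
    have "dsize (enc_list (fold f us [])) = dsize (enc_list us)"
      using mset[of us "[]"] by (simp add: dsize_enc_list flip: sum_mset_sum_list)
    then show "dsize (enc_list (fold f us [])) \<le> poly q (dsize (i x))"
      using q[OF x(1)] x(2) by (simp add: dsize_enc_list)
  qed (use assms ptime_const[of D i Atom] in simp_all)
  then show ?thesis by (simp add: sort)
qed

section \<open>Finite sets and graphs\<close>

lemma ptime_weaken: "ptime D i j \<Longrightarrow> ptime (SIGMA x:D. B x) (extend i e) (\<lambda>p. j (fst p))"
  by (rule ptime_up) auto

lemma ptime_restrict: "ptime D i j \<Longrightarrow> ptime {x \<in> D. P x} i j"
  by (erule ptime_subset) auto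

text \<open>\<open>enc_set\<close> sorts the codes, not the elements. Pulling their order back to
  the elements makes the rules for lists applicable to sets.\<close>

definition listing :: "('a \<Rightarrow> data) \<Rightarrow> 'a set \<Rightarrow> 'a list" where
  "listing e A = map (inv_into A e) (sorted_list_of_set (e ` A))"

lemma map_listing: "finite A \<Longrightarrow> map e (listing e A) = sorted_list_of_set (e ` A)"
  unfolding listing_def map_map
  by (rule map_idI) (auto intro: f_inv_into_f simp del: map_map)

lemma distinct_listing: "finite A \<Longrightarrow> distinct (listing e A)"
  using map_listing[of A e] by (metis distinct_map distinct_sorted_list_of_set)

lemma set_listing: "finite A \<Longrightarrow> inj_on e A \<Longrightarrow> set (listing e A) = A"
  by (simp add: listing_def inv_into_image_cancel)

lemma enc_set_listing: "finite A \<Longrightarrow> enc_set e A = enc_list (map e (listing e A))"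
  by (simp add: enc_set_def map_listing)

text \<open>A sublist of a sorted list is sorted, so the canonical code of a subset arises by
  deletion, without sorting.\<close>

lemma enc_set_filter:
  assumes "finite A" "inj_on e A"
  shows "enc_set e {a \<in> A. P a} = enc_list (map e (filter P (listing e A)))"
proof -
  let ?l = "map e (filter P (listing e A))"
  have "sorted (map e (listing e A))" "distinct (map e (listing e A))"
    using assms by (simp_all add: map_listing)
  then have "sorted ?l" "distinct ?l"
    by (auto simp: sorted_filter distinct_map_filter)
  moreover have "set ?l = e ` {a \<in> A. P a}" using set_listing[OF assms] by auto
  ultimately have "sorted_list_of_set (e ` {a \<in> A. P a}) = ?l"
    using assms(1) by (intro sorted_distinct_set_unique) auto
  then show ?thesis by (simp add: enc_set_def)
qed

lemma enc_set_empty_iff: "finite A \<Longrightarrow> enc_set e A = Atom \<longleftrightarrow> A = {}"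
  by (simp add: enc_set_def)

lemma ptime_set_filter:
  assumes "ptime D i (\<lambda>x. enc_set (e x) (A x))"
    and "\<And>x. x \<in> D \<Longrightarrow> finite (A x)" "\<And>x. x \<in> D \<Longrightarrow> inj_on (e x) (A x)"
    and "ptime (SIGMA x:D. A x) (extend i e) (\<lambda>p. enc_bool (P (fst p) (snd p)))"
  shows "ptime D i (\<lambda>x. enc_set (e x) {a \<in> A x. P x a})"
proof -
  have "ptime D i (\<lambda>x. enc_list (map (e x) (listing (e x) (A x))))"
    by (rule ptime_cong[OF assms(1)]) (simp_all add: assms(2) enc_set_listing)
  moreover have "(SIGMA x:D. set (listing (e x) (A x))) = (SIGMA x:D. A x)"
    by (intro Sigma_cong) (simp_all add: assms(2,3) set_listing)
  ultimately have "ptime D i (\<lambda>x. enc_list (map (e x) (filter (P x) (listing (e x) (A x)))))"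
    using assms(4) by (intro ptime_filter) simp_all
  then show ?thesis
    by (rule ptime_cong) (simp_all add: assms(2,3) enc_set_filter)
qed

lemma ptime_set_bex:
  assumes "ptime D i (\<lambda>x. enc_set (e x) (A x))"
    and "\<And>x. x \<in> D \<Longrightarrow> finite (A x)" "\<And>x. x \<in> D \<Longrightarrow> inj_on (e x) (A x)"
    and "ptime (SIGMA x:D. A x) (extend i e) (\<lambda>p. enc_bool (P (fst p) (snd p)))"
  shows "ptime D i (\<lambda>x. enc_bool (\<exists>a\<in>A x. P x a))"
proof -
  have "ptime D i (\<lambda>x. enc_bool (\<not> enc_set (e x) {a \<in> A x. P x a} = Atom))"
    by (intro ptime_not ptime_eq ptime_const ptime_set_filter assms)
  then show ?thesis
    by (rule ptime_cong) (auto simp: assms(2) enc_set_empty_iff)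
qed

lemma ptime_set_ball:
  assumes "ptime D i (\<lambda>x. enc_set (e x) (A x))"
    and "\<And>x. x \<in> D \<Longrightarrow> finite (A x)" "\<And>x. x \<in> D \<Longrightarrow> inj_on (e x) (A x)"
    and "ptime (SIGMA x:D. A x) (extend i e) (\<lambda>p. enc_bool (P (fst p) (snd p)))"
  shows "ptime D i (\<lambda>x. enc_bool (\<forall>a\<in>A x. P x a))"
  using ptime_not[OF ptime_set_bex[OF assms(1-3) ptime_not[OF assms(4)]]] by simp

lemma ptime_the_elem:
  assumes "ptime D i (\<lambda>x. enc_set (e x) {a x})"
  shows "ptime D i (\<lambda>x. e x (a x))"
  using ptime_left[OF assms] by (simp add: enc_set_def)

section \<open>Tests on vertices and vertex sets, and recoloring\<close>

lemma inj_on_enc_nat: "inj_on enc_nat A"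
  by (rule inj_on_subset[OF inj_enc_nat]) simp

lemma ptime_nat_eq:
  assumes "ptime D i (\<lambda>x. enc_nat (m x))" "ptime D i (\<lambda>x. enc_nat (n x))"
  shows "ptime D i (\<lambda>x. enc_bool (m x = n x))"
  using ptime_eq[OF assms] by (simp add: inj_eq[OF inj_enc_nat])

lemma ptime_nat_mem:
  assumes "ptime D i (\<lambda>x. enc_nat (v x))" "ptime D i (\<lambda>x. enc_set enc_nat (A x))"
    and "\<And>x. x \<in> D \<Longrightarrow> finite (A x)"
  shows "ptime D i (\<lambda>x. enc_bool (v x \<in> A x))"
proof -
  have "ptime D i (\<lambda>x. enc_bool (\<exists>a\<in>A x. a = v x))"
    by (rule ptime_set_bex[OF assms(2,3) inj_on_enc_nat ptime_nat_eq[OF ptime_snd ptime_weaken[OF assms(1)]]])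
  then show ?thesis by simp
qed

lemma ptime_nat_set_eq:
  assumes "ptime D i (\<lambda>x. enc_set enc_nat (A x))" "ptime D i (\<lambda>x. enc_set enc_nat (B x))"
    and "\<And>x. x \<in> D \<Longrightarrow> finite (A x)" "\<And>x. x \<in> D \<Longrightarrow> finite (B x)"
  shows "ptime D i (\<lambda>x. enc_bool (A x = B x))"
proof (rule ptime_cong[OF ptime_eq[OF assms(1,2)]])
  fix x assume "x \<in> D"
  then show "enc_bool (enc_set enc_nat (A x) = enc_set enc_nat (B x)) = enc_bool (A x = B x)"
    using enc_set_inject[OF inj_enc_nat assms(3,4)] by auto
qed simp

lemma inj_on_enc_set_nat: "(\<And>A. A \<in> X \<Longrightarrow> finite A) \<Longrightarrow> inj_on (enc_set enc_nat) X"
  by (rule inj_onI, rule enc_set_inject[OF inj_enc_nat]) blast+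

abbreviation enc_vertex :: "cgraph \<Rightarrow> nat \<Rightarrow> data" where
  "enc_vertex G v \<equiv> Pair (enc_nat v) (color G v)"

lemma inj_on_enc_vertex: "inj_on (\<lambda>v. Pair (enc_nat v) (c v)) A"
  by (rule inj_onI) (simp add: inj_eq[OF inj_enc_nat])

text \<open>The order in which vertices are listed does not depend on their colors, so recoloring a graph
  acts elementwise on its encoding.\<close>

lemma enc_set_colored:
  assumes "finite A"
  shows "enc_set (\<lambda>v. Pair (enc_nat v) (c v)) A =
    enc_list (map (\<lambda>v. Pair (enc_nat v) (c v)) (listing enc_nat A))"
proof -
  let ?e = "\<lambda>v. Pair (enc_nat v) (c v)"
  have "sorted (map enc_nat (listing enc_nat A))" "distinct (map enc_nat (listing enc_nat A))"
    using assms by (simp_all add: map_listing)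
  moreover have "sorted (map ?e vs)" if "sorted (map enc_nat vs)" "distinct (map enc_nat vs)" for vs
    using that by (induction vs) (force simp: image_iff)+
  ultimately have "sorted (map ?e (listing enc_nat A))" "distinct (map ?e (listing enc_nat A))"
    using inj_on_enc_vertex[of c] by (auto simp: distinct_map)
  moreover have "set (map ?e (listing enc_nat A)) = ?e ` A"
    using set_listing[OF assms inj_on_enc_nat] by simp
  ultimately have "sorted_list_of_set (?e ` A) = map ?e (listing enc_nat A)"
    using assms by (intro sorted_distinct_set_unique) auto
  then show ?thesis by (simp add: enc_set_def)
qed

text \<open>The result is a list in the order of vertex names. It is the code of a recolored vertex
  set if \<open>d\<close> yields name-color pairs, and of the plain vertex set if \<open>d\<close>
  drops the color.\<close>

lemma ptime_recolor:
  assumes "ptime D i (\<lambda>x. enc_set (\<lambda>v. Pair (enc_nat v) (c x v)) (A x))"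
    and "\<And>x. x \<in> D \<Longrightarrow> finite (A x)"
    and "ptime (SIGMA x:D. A x) (extend i (\<lambda>x v. Pair (enc_nat v) (c x v))) (\<lambda>p. d (fst p) (snd p))"
  shows "ptime D i (\<lambda>x. enc_list (map (d x) (listing enc_nat (A x))))"
proof -
  have 1: "ptime D i (\<lambda>x. enc_list (map (\<lambda>v. Pair (enc_nat v) (c x v)) (listing enc_nat (A x))))"
    by (rule ptime_cong[OF assms(1)]) (simp_all add: assms(2) enc_set_colored)
  have 2: "(SIGMA x:D. set (listing enc_nat (A x))) = (SIGMA x:D. A x)"
    using assms(2) by (intro Sigma_cong) (simp_all add: set_listing inj_on_enc_nat)
  show ?thesis
    by (rule ptime_map[OF 1]) (unfold 2, rule assms(3))
qed

section \<open>Graph primitives: adjacency, colors, induced subgraphs, adjacency types\<close>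

lemma simple_graph_finite:
  assumes "simple_graph G"
  shows "finite (verts G)" "finite (edges G)" "e \<in> edges G \<Longrightarrow> finite e"
proof -
  show f: "finite (verts G)" using assms by (simp add: simple_graph_def)
  have "edges G \<subseteq> Pow (verts G)" using assms by (auto simp: simple_graph_def)
  with f show "finite (edges G)" by (meson finite_Pow_iff finite_subset)
  show "e \<in> edges G \<Longrightarrow> finite e" using assms f by (auto simp: simple_graph_def dest: finite_subset)
qed

text \<open>Edges have exactly two elements, so adjacency of distinct vertices is a search for an
  edge containing both, which avoids building the code of \<open>{u, v}\<close>. For
  \<open>u = v\<close> any edge at \<open>u\<close> would falsely count.\<close>

lemma adj_iff:
  assumes "simple_graph G" "u \<noteq> v"
  shows "adj G u v \<longleftrightarrow> (\<exists>e\<in>edges G. u \<in> e \<and> v \<in> e)"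
proof
  assume "\<exists>e\<in>edges G. u \<in> e \<and> v \<in> e"
  then obtain e where e: "e \<in> edges G" "u \<in> e" "v \<in> e" by blast
  then have "card e = 2" "finite e" using assms simple_graph_finite by (auto simp: simple_graph_def)
  then have "{u, v} = e" using e assms(2) by (intro card_subset_eq) auto
  then show "adj G u v" using e by (simp add: adj_def)
qed (auto simp: adj_def)

lemma adj_type_eq_iff:
  "adj_type G A u = adj_type G A v \<longleftrightarrow> (\<forall>w\<in>verts G - A. adj G w u \<longleftrightarrow> adj G w v)"
  by (auto simp: adj_type_def)

lemma nontrivial_iff:
  "nontrivial G A \<longleftrightarrow> A \<noteq> verts G \<and> (\<exists>x\<in>A. \<exists>y\<in>A. x \<noteq> y \<and> adj_type G A x = adj_type G A y)"
  by (simp add: nontrivial_def adj_type_eq_iff)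

lemma verts_induced [simp]: "verts (induced G W) = W"
  and edges_induced [simp]: "edges (induced G W) = {e \<in> edges G. e \<subseteq> W}"
  by (simp_all add: induced_def)

lemma color_induced [simp]: "color (induced G W) = color G"
  by (simp add: induced_def)

context
  fixes D :: "'x set" and i :: "'x \<Rightarrow> data" and G :: "'x \<Rightarrow> cgraph"
  assumes G: "ptime D i (\<lambda>x. enc_cgraph (G x))"
    and simple: "\<And>x. x \<in> D \<Longrightarrow> simple_graph (G x)"
begin

lemma ptime_verts: "ptime D i (\<lambda>x. enc_set (enc_vertex (G x)) (verts (G x)))"
  using ptime_left[OF G] by (simp add: enc_cgraph_def)

lemma ptime_edges: "ptime D i (\<lambda>x. enc_set (enc_set enc_nat) (edges (G x)))"
  using ptime_right[OF G] by (simp add: enc_cgraph_def)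

lemma ptime_vertex_set: "ptime D i (\<lambda>x. enc_set enc_nat (verts (G x)))"
proof -
  have "ptime D i (\<lambda>x. enc_list (map enc_nat (listing enc_nat (verts (G x)))))"
    by (rule ptime_recolor[OF ptime_verts]) (simp_all add: simple simple_graph_finite ptime_trans[OF ptime_snd ptime_fst])
  then show ?thesis
    by (rule ptime_cong) (simp_all add: simple simple_graph_finite enc_set_listing)
qed

lemmas verts_rules = ptime_verts simple_graph_finite(1)[OF simple] inj_on_enc_vertex
lemmas edges_rules = ptime_edges simple_graph_finite(2)[OF simple]
  inj_on_enc_set_nat[OF simple_graph_finite(3)[OF simple]]

lemma ptime_adj:
  assumes "ptime D i (\<lambda>x. enc_nat (u x))" "ptime D i (\<lambda>x. enc_nat (v x))"
    and "\<And>x. x \<in> D \<Longrightarrow> u x \<noteq> v x"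
  shows "ptime D i (\<lambda>x. enc_bool (adj (G x) (u x) (v x)))"
proof -
  have "ptime D i (\<lambda>x. enc_bool (\<exists>e\<in>edges (G x). u x \<in> e \<and> v x \<in> e))"
    by (rule ptime_set_bex[OF edges_rules ptime_conj[OF _ ptime_restrict]])
      (auto intro!: ptime_nat_mem[OF ptime_weaken ptime_snd] assms simple_graph_finite(3)[OF simple])
  then show ?thesis
    by (rule ptime_cong) (simp_all add: adj_iff[OF simple] assms(3))
qed

lemma ptime_color:
  assumes "ptime D i (\<lambda>x. enc_nat (v x))" "\<And>x. x \<in> D \<Longrightarrow> v x \<in> verts (G x)"
  shows "ptime D i (\<lambda>x. color (G x) (v x))"
proof -
  have "ptime D i (\<lambda>x. enc_set (enc_vertex (G x)) {w \<in> verts (G x). w = v x})"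
    by (rule ptime_set_filter[OF verts_rules ptime_nat_eq[OF ptime_trans[OF ptime_snd ptime_fst] ptime_weaken[OF assms(1)]]])
  then have "ptime D i (\<lambda>x. enc_set (enc_vertex (G x)) {v x})"
    by (rule ptime_cong) (auto intro!: arg_cong[where f = "enc_set _"] simp: assms(2))
  from ptime_right[OF ptime_the_elem[OF this]] show ?thesis by simp
qed

lemma ptime_induced:
  assumes "ptime D i (\<lambda>x. enc_set enc_nat (W x))" "\<And>x. x \<in> D \<Longrightarrow> W x \<subseteq> verts (G x)"
  shows "ptime D i (\<lambda>x. enc_cgraph (induced (G x) (W x)))"
proof -
  have fin: "finite (W x)" if "x \<in> D" for x
    using that assms(2) simple_graph_finite(1)[OF simple] finite_subset by blast
  have "ptime D i (\<lambda>x. enc_set (enc_vertex (G x)) {v \<in> verts (G x). v \<in> W x})"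
    by (rule ptime_set_filter[OF verts_rules
          ptime_nat_mem[OF ptime_trans[OF ptime_snd ptime_fst] ptime_weaken[OF assms(1)]]]) (auto intro: fin)
  then have V: "ptime D i (\<lambda>x. enc_set (enc_vertex (G x)) (W x))"
    by (rule ptime_cong) (use assms(2) in \<open>auto intro!: arg_cong[where f = "enc_set _"]\<close>)
  let ?E = "SIGMA x:D. edges (G x)"
  let ?i = "extend i (\<lambda>_. enc_set enc_nat)"
  have "ptime ?E ?i (\<lambda>p. enc_bool (\<forall>u\<in>snd p. u \<in> W (fst p)))"
    by (rule ptime_set_ball[OF ptime_snd _ inj_on_enc_nat
          ptime_nat_mem[OF ptime_snd ptime_weaken[OF ptime_weaken[OF assms(1)]]]])
      (auto intro: fin simple_graph_finite(3)[OF simple])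
  then have "ptime D i (\<lambda>x. enc_set (enc_set enc_nat) {e \<in> edges (G x). \<forall>u\<in>e. u \<in> W x})"
    by - (rule ptime_set_filter[OF edges_rules], assumption)
  from ptime_pair[OF V this] show ?thesis
    by (simp add: enc_cgraph_def subset_eq)
qed

end

lemma ptime_same_type:
  assumes G: "ptime D i (\<lambda>x. enc_cgraph (G x))" and simple: "\<And>x. x \<in> D \<Longrightarrow> simple_graph (G x)"
    and A: "ptime D i (\<lambda>x. enc_set enc_nat (A x))" "\<And>x. x \<in> D \<Longrightarrow> finite (A x)"
    and u: "ptime D i (\<lambda>x. enc_nat (u x))" "\<And>x. x \<in> D \<Longrightarrow> u x \<in> A x"
    and v: "ptime D i (\<lambda>x. enc_nat (v x))" "\<And>x. x \<in> D \<Longrightarrow> v x \<in> A x"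
  shows "ptime D i (\<lambda>x. enc_bool (adj_type (G x) (A x) (u x) = adj_type (G x) (A x) (v x)))"
proof -
  let ?E = "SIGMA x:D. verts (G x)"
  let ?i = "extend i (\<lambda>x. enc_vertex (G x))"
  have w: "ptime ?E ?i (\<lambda>p. enc_nat (snd p))"
    by (rule ptime_trans[OF ptime_snd ptime_fst])
  have "ptime ?E ?i (\<lambda>p. enc_bool (snd p \<notin> A (fst p)))"
    by (rule ptime_not[OF ptime_nat_mem[OF w ptime_weaken[OF A(1)]]]) (auto intro: A)
  \<comment> \<open>A vertex outside \<open>A\<close> differs from \<open>u\<close> and
    \<open>v\<close>, as the search for an edge requires.\<close>
  moreover have "ptime {p \<in> ?E. snd p \<notin> A (fst p)} ?i
      (\<lambda>p. enc_bool (adj (G (fst p)) (snd p) (u (fst p)) = adj (G (fst p)) (snd p) (v (fst p))))"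
    by (rule ptime_iff; rule ptime_adj[OF ptime_restrict[OF ptime_weaken[OF G]] _ ptime_restrict[OF w]
          ptime_restrict[OF ptime_weaken]])
      (use u v in \<open>auto intro: simple\<close>)
  ultimately have "ptime ?E ?i (\<lambda>p. enc_bool (snd p \<notin> A (fst p) \<longrightarrow>
      (adj (G (fst p)) (snd p) (u (fst p)) \<longleftrightarrow> adj (G (fst p)) (snd p) (v (fst p)))))"
    by (rule ptime_imp)
  then have "ptime D i (\<lambda>x. enc_bool (\<forall>w\<in>verts (G x). w \<notin> A x \<longrightarrow>
      (adj (G x) w (u x) \<longleftrightarrow> adj (G x) w (v x))))"
    by - (rule ptime_set_ball[OF verts_rules[OF G simple]], assumption)
  then show ?thesis
    by (simp add: adj_type_eq_iff Ball_def imp_conjL)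
qed

lemma ptime_nontrivial:
  assumes G: "ptime D i (\<lambda>x. enc_cgraph (G x))" "\<And>x. x \<in> D \<Longrightarrow> simple_graph (G x)"
    and A: "ptime D i (\<lambda>x. enc_set enc_nat (A x))" "\<And>x. x \<in> D \<Longrightarrow> finite (A x)"
  shows "ptime D i (\<lambda>x. enc_bool (nontrivial (G x) (A x)))"
proof -
  let ?E = "SIGMA x:D. A x"
  let ?F = "SIGMA p:?E. A (fst p)"
  let ?i = "extend i (\<lambda>_. enc_nat)"
  let ?j = "extend ?i (\<lambda>_. enc_nat)"
  note up = ptime_weaken[OF ptime_weaken]
  have FA: "\<And>p. p \<in> ?E \<Longrightarrow> finite (A (fst p))" using A(2) by auto
  have x: "ptime ?F ?j (\<lambda>q. enc_nat (snd (fst q)))"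
    by (rule ptime_weaken[OF ptime_snd])
  have "ptime {q \<in> ?F. snd (fst q) \<noteq> snd q} ?j (\<lambda>q. enc_bool
      (adj_type (G (fst (fst q))) (A (fst (fst q))) (snd (fst q)) =
       adj_type (G (fst (fst q))) (A (fst (fst q))) (snd q)))"
    by (rule ptime_same_type[OF ptime_restrict[OF up[OF G(1)]] _ ptime_restrict[OF up[OF A(1)]] _
          ptime_restrict[OF x] _ ptime_restrict[OF ptime_snd]]) (auto intro: G A)
  from ptime_conj[OF ptime_not[OF ptime_nat_eq[OF x ptime_snd]] this]
  have "ptime ?F ?j (\<lambda>q. enc_bool (snd (fst q) \<noteq> snd q \<and>
      adj_type (G (fst (fst q))) (A (fst (fst q))) (snd (fst q)) =
      adj_type (G (fst (fst q))) (A (fst (fst q))) (snd q)))" .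
  then have "ptime ?E ?i (\<lambda>p. enc_bool (\<exists>y\<in>A (fst p). snd p \<noteq> y \<and>
      adj_type (G (fst p)) (A (fst p)) (snd p) = adj_type (G (fst p)) (A (fst p)) y))"
    by - (rule ptime_set_bex[OF ptime_weaken[OF A(1)] FA inj_on_enc_nat], assumption)
  then have "ptime D i (\<lambda>x. enc_bool (\<exists>u\<in>A x. \<exists>y\<in>A x. u \<noteq> y \<and>
      adj_type (G x) (A x) u = adj_type (G x) (A x) y))"
    by - (rule ptime_set_bex[OF A inj_on_enc_nat], assumption)
  then have "ptime D i (\<lambda>x. enc_bool (A x \<noteq> verts (G x) \<and> (\<exists>u\<in>A x. \<exists>y\<in>A x. u \<noteq> y \<and>
      adj_type (G x) (A x) u = adj_type (G x) (A x) y)))"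
    by (intro ptime_conj ptime_restrict ptime_not ptime_nat_set_eq[OF A(1) ptime_vertex_set[OF G] A(2)]
        simple_graph_finite(1) G(2))
  then show ?thesis by (simp add: nontrivial_iff)
qed

text \<open>Multiplicities matter, so colors are listed vertex by vertex and then sorted; passing
  through a set would merge equal colors. Sorting removes the dependence on vertex names.\<close>

lemma ptime_color_list:
  assumes G: "ptime D i (\<lambda>x. enc_cgraph (G x))" "\<And>x. x \<in> D \<Longrightarrow> simple_graph (G x)"
    and A: "ptime D i (\<lambda>x. enc_set enc_nat (A x))" "\<And>x. x \<in> D \<Longrightarrow> A x \<subseteq> verts (G x)"
  shows "ptime D i (\<lambda>x. enc_list (sorted_list_of_multiset (image_mset (color (G x)) (mset_set (A x)))))"
proof -
  have fin: "finite (A x)" if "x \<in> D" for x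
    using that A(2) simple_graph_finite(1)[OF G(2)] finite_subset by blast
  have 1: "ptime D i (\<lambda>x. enc_list (map enc_nat (listing enc_nat (A x))))"
    by (rule ptime_cong[OF A(1)]) (simp_all add: fin enc_set_listing)
  have "ptime (SIGMA x:D. set (listing enc_nat (A x))) (extend i (\<lambda>_. enc_nat))
      (\<lambda>p. color (G (fst p)) (snd p))"
    by (rule ptime_color[OF ptime_weaken[OF G(1)] _ ptime_snd])
      (auto intro: G subsetD[OF A(2)] simp: fin set_listing inj_on_enc_nat)
  from ptime_sort[OF ptime_map[OF 1 this]]
  have "ptime D i (\<lambda>x. enc_list (sort (map (color (G x)) (listing enc_nat (A x)))))" .
  then show ?thesis
  proof (rule ptime_cong)
    fix x assume x: "x \<in> D"
    from distinct_listing[OF fin[OF x]] have "mset (listing enc_nat (A x)) = mset_set (A x)"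
      using mset_set_set set_listing[OF fin[OF x] inj_on_enc_nat] by metis
    then show "enc_list (sort (map (color (G x)) (listing enc_nat (A x)))) =
        enc_list (sorted_list_of_multiset (image_mset (color (G x)) (mset_set (A x))))"
      by (metis mset_map sorted_list_of_multiset_mset)
  qed simp
qed

section \<open>Computing quotients\<close>

locale polytime_decomposition =
  fixes C :: "graph set" and \<M> :: decomposition and R :: replacement
  assumes simple_C: "\<forall>G\<in>C. simple_graph G"
    and hereditary_C: "hereditary C"
    and functor_\<M>: "decomposition_functor C \<M>"
    and ptime_\<M>: "poly_time_decomposition C \<M>"
    and replacement_R: "replacement_operator C \<M> R"
    and ptime_R: "poly_time_replacement C \<M> R"
begin

lemma colored_simple: "G \<in> colored C \<Longrightarrow> simple_graph G"
  using simple_C unfolding colored_def simple_graph_def graph.truncate_def by force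

lemma colored_induced: "G \<in> colored C \<Longrightarrow> W \<subseteq> verts G \<Longrightarrow> induced G W \<in> colored C"
  using hereditary_C unfolding colored_def hereditary_def induced_def graph.truncate_def by force

lemma modules_partition: "G \<in> colored C \<Longrightarrow> partition_on (\<Union>(\<M> G)) (\<M> G)"
  using functor_\<M> unfolding decomposition_functor_def by blast

lemma module_subset: "G \<in> colored C \<Longrightarrow> A \<in> \<M> G \<Longrightarrow> A \<subseteq> verts G"
  using functor_\<M> unfolding decomposition_functor_def colored_module_def by blast

lemma module_finite: "G \<in> colored C \<Longrightarrow> A \<in> \<M> G \<Longrightarrow> finite A"
  using module_subset simple_graph_finite(1)[OF colored_simple] finite_subset by blast

lemma modules_finite: "G \<in> colored C \<Longrightarrow> finite (\<M> G)"
  using module_subset simple_graph_finite(1)[OF colored_simple]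
  by (meson Pow_iff finite_Pow_iff finite_subset subsetI)

lemma module_at_eq:
  assumes "G \<in> colored C" "A \<in> \<M> G" "v \<in> A"
  shows "module_at \<M> G v = A"
  unfolding module_at_def
proof (rule the_equality)
  fix B assume "B \<in> \<M> G \<and> v \<in> B"
  then show "B = A"
    using assms partition_onD2[OF modules_partition[OF assms(1)]] by (auto dest: disjointD)
qed (use assms in simp)

lemma replacement_verts:
  "G \<in> colored C \<Longrightarrow> A \<in> \<M> G \<Longrightarrow> nontrivial G A \<Longrightarrow> verts (R G A) \<subseteq> A"
  using replacement_R unfolding replacement_operator_def by blast

lemma replacement_simple:
  assumes "G \<in> colored C" "A \<in> \<M> G" "nontrivial G A"
  shows "simple_graph (R G A)"
proof -
  have "edges (R G A) = {e \<in> edges G. e \<subseteq> verts (R G A)}"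
    using replacement_R assms unfolding replacement_operator_def by auto
  moreover have "finite (verts (R G A))"
    using replacement_verts[OF assms] module_finite[OF assms(1,2)] finite_subset by blast
  ultimately show ?thesis
    using colored_simple[OF assms(1)] by (auto simp: simple_graph_def)
qed

lemma ptime_modules:
  assumes "ptime D i (\<lambda>x. enc_cgraph (G x))" "\<And>x. x \<in> D \<Longrightarrow> G x \<in> colored C"
  shows "ptime D i (\<lambda>x. enc_set (enc_set enc_nat) (\<M> (G x)))"
proof -
  have "ptime (colored C) enc_cgraph (\<lambda>G. enc_set (enc_set enc_nat) (\<M> G))"
    using ptime_\<M> unfolding poly_time_decomposition_def poly_time_computable_def ptime_def by simp
  from ptime_call[OF this assms] show ?thesis .
qed

lemma ptime_replacement:
  assumes "ptime D i (\<lambda>x. enc_cgraph (G x))" "ptime D i (\<lambda>x. enc_set enc_nat (A x))"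
    and "\<And>x. x \<in> D \<Longrightarrow> G x \<in> colored C" "\<And>x. x \<in> D \<Longrightarrow> A x \<in> \<M> (G x)"
    and "\<And>x. x \<in> D \<Longrightarrow> nontrivial (G x) (A x)"
  shows "ptime D i (\<lambda>x. enc_cgraph (R (G x) (A x)))"
proof -
  have 1: "ptime {(G, A). G \<in> colored C \<and> A \<in> \<M> G \<and> nontrivial G A}
      (\<lambda>p. Pair (enc_cgraph (fst p)) (enc_set enc_nat (snd p))) (\<lambda>p. enc_cgraph (R (fst p) (snd p)))"
    using ptime_R
    unfolding poly_time_replacement_def poly_time_computable_def ptime_def enc_prod_def case_prod_beta
    by simp
  have "ptime D i (\<lambda>x. Pair (enc_cgraph (fst (G x, A x))) (enc_set enc_nat (snd (G x, A x))))"
    using ptime_pair[OF assms(1,2)] by simp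
  from ptime_call[OF 1 this] show ?thesis using assms(3-5) by simp
qed

lemma modules_rules:
  assumes "ptime D i (\<lambda>x. enc_cgraph (G x))" "\<And>x. x \<in> D \<Longrightarrow> G x \<in> colored C"
  shows "ptime D i (\<lambda>x. enc_set (enc_set enc_nat) (\<M> (G x)))"
    and "\<And>x. x \<in> D \<Longrightarrow> finite (\<M> (G x))"
    and "\<And>x. x \<in> D \<Longrightarrow> inj_on (enc_set enc_nat) (\<M> (G x))"
  using ptime_modules[OF assms] assms(2)
  by (blast intro: modules_finite inj_on_enc_set_nat module_finite)+

lemma ptime_prime:
  assumes "ptime D i (\<lambda>x. enc_cgraph (G x))" "\<And>x. x \<in> D \<Longrightarrow> G x \<in> colored C"
  shows "ptime D i (\<lambda>x. enc_bool (prime_wrt \<M> (G x)))"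
  unfolding prime_wrt_def
  by (rule ptime_set_ball[OF modules_rules[OF assms] ptime_not[OF ptime_nontrivial[OF
          ptime_weaken[OF assms(1)] _ ptime_snd]]])
    (auto intro: colored_simple[OF assms(2)] module_finite[OF assms(2)])

lemma ptime_in_modules:
  assumes "ptime D i (\<lambda>x. enc_cgraph (G x))" "\<And>x. x \<in> D \<Longrightarrow> G x \<in> colored C"
    and "ptime D i (\<lambda>x. enc_nat (v x))"
  shows "ptime D i (\<lambda>x. enc_bool (v x \<in> \<Union>(\<M> (G x))))"
  unfolding Union_iff
  by (rule ptime_set_bex[OF modules_rules[OF assms(1,2)] ptime_nat_mem[OF ptime_weaken[OF assms(3)]
          ptime_snd]])
    (auto intro: module_finite[OF assms(2)])

lemma ptime_module_at:
  assumes "ptime D i (\<lambda>x. enc_cgraph (G x))" "\<And>x. x \<in> D \<Longrightarrow> G x \<in> colored C"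
    and "ptime D i (\<lambda>x. enc_nat (v x))" "\<And>x. x \<in> D \<Longrightarrow> v x \<in> \<Union>(\<M> (G x))"
  shows "ptime D i (\<lambda>x. enc_set enc_nat (module_at \<M> (G x) (v x)))"
proof -
  have "ptime D i (\<lambda>x. enc_set (enc_set enc_nat) {A \<in> \<M> (G x). v x \<in> A})"
    by (rule ptime_set_filter[OF modules_rules[OF assms(1,2)] ptime_nat_mem[OF ptime_weaken[OF assms(3)]
            ptime_snd]])
      (auto intro: module_finite[OF assms(2)])
  moreover have "{A \<in> \<M> (G x). v x \<in> A} = {module_at \<M> (G x) (v x)}" if "x \<in> D" for x
  proof -
    obtain A where "A \<in> \<M> (G x)" "v x \<in> A" using assms(4)[OF \<open>x \<in> D\<close>] by blast
    then show ?thesis using module_at_eq[OF assms(2)[OF \<open>x \<in> D\<close>]] by auto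
  qed
  ultimately have "ptime D i (\<lambda>x. enc_set (enc_set enc_nat) {module_at \<M> (G x) (v x)})"
    using ptime_cong by (metis (no_types, lifting))
  then show ?thesis by (rule ptime_the_elem)
qed

lemma ptime_quotient_verts:
  assumes "ptime D i (\<lambda>x. enc_cgraph (G x))" "\<And>x. x \<in> D \<Longrightarrow> G x \<in> colored C"
  shows "ptime D i (\<lambda>x. enc_set enc_nat (quotient_verts \<M> R (G x)))"
proof -
  have S: "\<And>x. x \<in> D \<Longrightarrow> simple_graph (G x)" by (rule colored_simple[OF assms(2)])
  let ?E = "SIGMA x:D. verts (G x)"
  let ?F = "SIGMA p:?E. \<M> (G (fst p))"
  let ?i = "extend i (\<lambda>_. enc_nat)"
  let ?j = "extend ?i (\<lambda>_. enc_set enc_nat)"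
  let ?P = "\<lambda>q. nontrivial (G (fst (fst q))) (snd q) \<and> snd (fst q) \<in> snd q"
  have G: "ptime ?E ?i (\<lambda>p. enc_cgraph (G (fst p)))" by (rule ptime_weaken[OF assms(1)])
  have GE: "\<And>p. p \<in> ?E \<Longrightarrow> G (fst p) \<in> colored C" using assms(2) by auto
  have G': "ptime ?F ?j (\<lambda>p. enc_cgraph (G (fst (fst p))))" by (rule ptime_weaken[OF G])
  have v: "ptime ?F ?j (\<lambda>q. enc_nat (snd (fst q)))" by (rule ptime_weaken[OF ptime_snd])
  have "ptime ?F ?j (\<lambda>q. enc_bool (?P q))"
    by (rule ptime_conj[OF ptime_nontrivial[OF G' _ ptime_snd] ptime_restrict[OF ptime_nat_mem[OF v ptime_snd]]])
      (auto intro: S module_finite[OF assms(2)])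
  \<comment> \<open>\<open>R\<close> may be called only on non-trivial modules, hence the conclusion
    of the implication is evaluated under its premise.\<close>
  moreover have "ptime {q \<in> ?F. ?P q} ?j
      (\<lambda>q. enc_bool (snd (fst q) \<in> verts (R (G (fst (fst q))) (snd q))))"
  proof (rule ptime_nat_mem[OF ptime_restrict[OF v] ptime_vertex_set[OF ptime_replacement[OF
            ptime_restrict[OF G'] ptime_restrict[OF ptime_snd]]]])
    fix q assume q: "q \<in> {q \<in> ?F. ?P q}"
    then show "simple_graph (R (G (fst (fst q))) (snd q))"
      using assms(2) by (auto intro!: replacement_simple)
    then show "finite (verts (R (G (fst (fst q))) (snd q)))"
      by (rule simple_graph_finite)
  qed (use assms(2) in auto)
  ultimately have "ptime ?F ?j (\<lambda>q. enc_bool (?P q \<longrightarrow> snd (fst q) \<in> verts (R (G (fst (fst q))) (snd q))))"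
    by (rule ptime_imp)
  then have "ptime ?E ?i (\<lambda>p. enc_bool (\<forall>A\<in>\<M> (G (fst p)). nontrivial (G (fst p)) A \<and> snd p \<in> A \<longrightarrow>
      snd p \<in> verts (R (G (fst p)) A)))"
    by - (rule ptime_set_ball[OF modules_rules[OF G GE]], assumption)
  then show ?thesis
    unfolding quotient_verts_def
    by - (rule ptime_set_filter[OF ptime_vertex_set[OF assms(1) S] simple_graph_finite(1)[OF S] inj_on_enc_nat], assumption)
qed

text \<open>The invariant may vary with the instance and has to be computable only on the subgraphs
  induced by modules. Both liberties are used when it is read off a table.\<close>

lemma ptime_quotient_color:
  assumes G: "ptime D i (\<lambda>x. enc_cgraph (G x))" "\<And>x. x \<in> D \<Longrightarrow> G x \<in> colored C"
    and v: "ptime D i (\<lambda>x. enc_nat (v x))" "\<And>x. x \<in> D \<Longrightarrow> v x \<in> quotient_verts \<M> R (G x)"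
    and I: "ptime (SIGMA x:D. \<M> (G x)) (extend i (\<lambda>_. enc_set enc_nat))
      (\<lambda>p. I (fst p) (induced (G (fst p)) (snd p)))"
  shows "ptime D i (\<lambda>x. quotient_color \<M> R (I x) (G x) (v x))"
proof -
  have S: "\<And>x. x \<in> D \<Longrightarrow> simple_graph (G x)" by (rule colored_simple[OF G(2)])
  have vG: "\<And>x. x \<in> D \<Longrightarrow> v x \<in> verts (G x)" using v(2) by (simp add: quotient_verts_def)
  have c: "ptime D i (\<lambda>x. color (G x) (v x))" by (rule ptime_color[OF G(1) S v(1) vG])
  let ?D = "{x \<in> D. v x \<in> \<Union>(\<M> (G x))}"
  define A where "A x = module_at \<M> (G x) (v x)" for x
  have Aiff: "A x \<in> \<M> (G x) \<and> v x \<in> A x" if "x \<in> ?D" for x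
    using that module_at_eq[OF G(2)] by (auto simp: A_def)
  have AM: "\<And>x. x \<in> ?D \<Longrightarrow> A x \<in> \<M> (G x)" and vA: "\<And>x. x \<in> ?D \<Longrightarrow> v x \<in> A x"
    using Aiff by blast+
  have GD: "\<And>x. x \<in> ?D \<Longrightarrow> G x \<in> colored C" and SD: "\<And>x. x \<in> ?D \<Longrightarrow> simple_graph (G x)"
    using G(2) S by auto
  have fA: "\<And>x. x \<in> ?D \<Longrightarrow> finite (A x)" and sA: "\<And>x. x \<in> ?D \<Longrightarrow> A x \<subseteq> verts (G x)"
    using module_finite[OF GD AM] module_subset[OF GD AM] by blast+
  note G' = ptime_restrict[OF G(1)]
  note v' = ptime_restrict[OF v(1)]
  have A: "ptime ?D i (\<lambda>x. enc_set enc_nat (A x))"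
    unfolding A_def by (rule ptime_module_at[OF G' _ v']) (use G(2) in auto)
  let ?E = "SIGMA x:?D. A x"
  let ?T = "\<lambda>x. {u \<in> A x. adj_type (G x) (A x) u = adj_type (G x) (A x) (v x)}"
  have T: "ptime ?D i (\<lambda>x. enc_set enc_nat (?T x))"
    by (rule ptime_set_filter[OF A fA inj_on_enc_nat ptime_same_type[OF ptime_weaken[OF G'] _
            ptime_weaken[OF A] _ ptime_snd _ ptime_weaken[OF v']]])
      (assumption | (erule SigmaE, simp only: fst_conv snd_conv SD fA vA))+
  have L: "ptime ?D i (\<lambda>x. enc_list (sorted_list_of_multiset (image_mset (color (G x)) (mset_set (?T x)))))"
    by (rule ptime_color_list[OF G' SD T]) (use sA in auto)
  let ?N = "\<lambda>x. nontrivial (G x) (A x)"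
  have "ptime {x \<in> ?D. ?N x} i (\<lambda>x. color (R (G x) (A x)) (v x))"
  proof (rule ptime_color[OF ptime_replacement[OF ptime_restrict[OF G'] ptime_restrict[OF A]] _ ptime_restrict[OF v']])
    fix x assume x: "x \<in> {x \<in> ?D. ?N x}"
    then show "simple_graph (R (G x) (A x))"
      using GD AM by (intro replacement_simple) auto
    \<comment> \<open>A vertex that survives in the quotient belongs to the replacement of its
      module, so its new color can be looked up there.\<close>
    show "v x \<in> verts (R (G x) (A x))"
      using x v(2)[of x] AM[of x] vA[of x] by (auto simp: quotient_verts_def)
  qed (use GD AM in auto)
  from ptime_If[OF ptime_nontrivial[OF G' SD A fA] this ptime_restrict[OF ptime_restrict[OF c]]]
  have chi: "ptime ?D i (\<lambda>x. if ?N x then color (R (G x) (A x)) (v x) else color (G x) (v x))" .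
  have "ptime ?D i (\<lambda>x. extend i (\<lambda>_. enc_set enc_nat) (x, A x))"
    using ptime_pair[OF ptime_refl A] by simp
  from ptime_call[OF I this] have "ptime ?D i (\<lambda>x. I x (induced (G x) (A x)))"
    using AM by auto
  from ptime_pair[OF chi ptime_pair[OF L this]]
  have "ptime ?D i (\<lambda>x. quotient_color \<M> R (I x) (G x) (v x))"
    by (rule ptime_cong) (simp_all add: quotient_color_def A_def Let_def)
  moreover have "ptime {x \<in> D. v x \<notin> \<Union>(\<M> (G x))} i (\<lambda>x. quotient_color \<M> R (I x) (G x) (v x))"
    by (rule ptime_cong[OF ptime_pair[OF ptime_restrict[OF c] ptime_const[of _ _ "Pair (enc_list []) Atom"]]])
      (simp_all add: quotient_color_def)
  ultimately show ?thesis
    using ptime_If[OF ptime_in_modules[OF G v(1)]] by fastforce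
qed

lemma ptime_quotient:
  assumes G: "ptime D i (\<lambda>x. enc_cgraph (G x))" "\<And>x. x \<in> D \<Longrightarrow> G x \<in> colored C"
    and I: "ptime (SIGMA x:D. \<M> (G x)) (extend i (\<lambda>_. enc_set enc_nat))
      (\<lambda>p. I (fst p) (induced (G (fst p)) (snd p)))"
  shows "ptime D i (\<lambda>x. enc_cgraph (quotient \<M> R (I x) (G x)))"
proof -
  let ?Q = "\<lambda>x. quotient_verts \<M> R (G x)"
  have Q: "?Q x \<subseteq> verts (G x)" for x by (auto simp: quotient_verts_def)
  have fin: "finite (?Q x)" if "x \<in> D" for x
    using simple_graph_finite(1)[OF colored_simple[OF G(2)[OF that]]] Q finite_subset by blast
  have H: "ptime D i (\<lambda>x. enc_cgraph (induced (G x) (?Q x)))"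
    by (rule ptime_induced[OF G(1) colored_simple[OF G(2)] ptime_quotient_verts[OF G] Q])
  have V: "ptime D i (\<lambda>x. enc_set (enc_vertex (G x)) (?Q x))"
    using ptime_left[OF H] by (simp add: enc_cgraph_def)
  let ?E = "SIGMA x:D. ?Q x"
  let ?i = "extend i (\<lambda>x. enc_vertex (G x))"
  have v: "ptime ?E ?i (\<lambda>p. enc_nat (snd p))" by (rule ptime_trans[OF ptime_snd ptime_fst])
  let ?F = "SIGMA p:?E. \<M> (G (fst p))"
  let ?j = "extend ?i (\<lambda>_. enc_set enc_nat)"
  have "ptime ?F ?j (\<lambda>q. extend i (\<lambda>_. enc_set enc_nat) (fst (fst q), snd q))"
    using ptime_pair[OF ptime_weaken[OF ptime_weaken[OF ptime_refl]] ptime_snd] by simp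
  from ptime_call[OF I this]
  have "ptime ?F ?j (\<lambda>q. I (fst (fst q)) (induced (G (fst (fst q))) (snd q)))"
    by (auto simp del: split_paired_All)
  from ptime_pair[OF v ptime_quotient_color[OF ptime_weaken[OF G(1)] _ v _ this]]
  have "ptime ?E ?i (\<lambda>p. Pair (enc_nat (snd p)) (quotient_color \<M> R (I (fst p)) (G (fst p)) (snd p)))"
    using G(2) by auto
  from ptime_recolor[OF V fin this]
  have "ptime D i (\<lambda>x. enc_set (\<lambda>v. Pair (enc_nat v) (quotient_color \<M> R (I x) (G x) v)) (?Q x))"
    by (rule ptime_cong) (simp_all add: enc_set_colored fin)
  \<comment> \<open>Only the vertex half of the code is rewritten; the quotient has the edges of the
    induced subgraph.\<close>
  from ptime_pair[OF this ptime_right[OF H]] show ?thesis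
    by (simp add: enc_cgraph_def quotient_def)
qed

end

section \<open>The isomorphism test\<close>

lemma dsize_enc_set_filter_le:
  assumes "finite A" "inj_on e A"
  shows "dsize (enc_set e {a \<in> A. P a}) \<le> dsize (enc_set e A)"
proof -
  have "(\<Sum>x\<leftarrow>filter P xs. Suc (dsize (e x))) \<le> (\<Sum>x\<leftarrow>xs. Suc (dsize (e x)))" for xs
    by (induction xs) auto
  then show ?thesis
    unfolding enc_set_filter[OF assms] enc_set_listing[OF assms(1)]
    by (simp add: dsize_enc_list o_def)
qed

text \<open>The codes of both the vertex set and the edge set arise by deletion. This keeps every
  graph of the recursion within the size of the input.\<close>

lemma dsize_induced_le:
  assumes "simple_graph G" "W \<subseteq> verts G"
  shows "dsize (enc_cgraph (induced G W)) \<le> dsize (enc_cgraph G)"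
proof -
  have "W = {v \<in> verts G. v \<in> W}" using assms(2) by auto
  then have "dsize (enc_set (enc_vertex G) W) \<le> dsize (enc_set (enc_vertex G) (verts G))"
    using dsize_enc_set_filter_le[OF simple_graph_finite(1)[OF assms(1)] inj_on_enc_vertex] by metis
  moreover have "dsize (enc_set (enc_set enc_nat) {e \<in> edges G. e \<subseteq> W}) \<le>
      dsize (enc_set (enc_set enc_nat) (edges G))"
    by (rule dsize_enc_set_filter_le[OF simple_graph_finite(2)[OF assms(1)]
          inj_on_enc_set_nat[OF simple_graph_finite(3)[OF assms(1)]]])
  ultimately show ?thesis by (simp add: enc_cgraph_def)
qed

lemma card_verts_le_dsize:
  assumes "simple_graph G"
  shows "card (verts G) \<le> dsize (enc_cgraph G)"
proof -
  let ?e = "enc_vertex G"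
  have fin: "finite (verts G)" by (rule simple_graph_finite[OF assms])
  have "card (verts G) = card (?e ` verts G)" by (rule card_image[symmetric, OF inj_on_enc_vertex])
  also have "\<dots> = length (sorted_list_of_set (?e ` verts G))" by simp
  also have "\<dots> \<le> dsize (enc_set ?e (verts G))" unfolding enc_set_def by (rule length_le_dsize)
  finally show ?thesis by (simp add: enc_cgraph_def)
qed

text \<open>Non-triviality is pulled back along the isomorphism, which is the direction that carries
  primality from \<open>G\<close> to \<open>H\<close>.\<close>

lemma nontrivial_iso:
  assumes "is_iso \<phi> G H" "A \<subseteq> verts G" "nontrivial H (\<phi> ` A)"
  shows "nontrivial G A"
proof -
  from assms(1) have inj: "inj_on \<phi> (verts G)" and im: "\<phi> ` verts G = verts H"
    and adj: "\<And>u v. u \<in> verts G \<Longrightarrow> v \<in> verts G \<Longrightarrow> adj G u v \<longleftrightarrow> adj H (\<phi> u) (\<phi> v)"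
    by (auto simp: is_iso_def bij_betw_def)
  from assms(3) obtain x y where xy: "x \<in> A" "y \<in> A" "\<phi> x \<noteq> \<phi> y"
    and eq: "\<forall>v\<in>verts H - \<phi> ` A. adj H v (\<phi> x) \<longleftrightarrow> adj H v (\<phi> y)" and ne: "\<phi> ` A \<noteq> verts H"
    unfolding nontrivial_def by auto
  have "adj G v x \<longleftrightarrow> adj G v y" if v: "v \<in> verts G - A" for v
  proof -
    have "\<phi> v \<in> verts H - \<phi> ` A"
      using v inj im assms(2) by (auto dest: inj_onD)
    then show ?thesis using eq adj v xy assms(2) by (auto simp: subset_eq)
  qed
  moreover have "A \<noteq> verts G" using ne im by blast
  moreover have "x \<noteq> y" using xy(3) by blast
  ultimately show ?thesis unfolding nontrivial_def using xy(1,2) by blast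
qed

text \<open>A table pairs graphs with representatives of their isomorphism classes.\<close>

type_synonym table = "(cgraph \<times> cgraph) list"

definition enc_entry :: "cgraph \<times> cgraph \<Rightarrow> data" where
  "enc_entry p = Pair (enc_cgraph (fst p)) (enc_cgraph (snd p))"

text \<open>The second clause makes lookups unambiguous: all entries of one isomorphism class share
  literally the same representative.\<close>

definition valid_table :: "table \<Rightarrow> bool" where
  "valid_table T \<longleftrightarrow>
    (\<forall>p\<in>set T. simple_graph (fst p) \<and> simple_graph (snd p) \<and> isomorphic (fst p) (snd p)) \<and>
    (\<forall>p\<in>set T. \<forall>q\<in>set T. isomorphic (fst p) (fst q) \<longrightarrow> snd p = snd q)"

text \<open>A complete invariant has to distinguish all graphs. Classes missing from the table get
  an arbitrary representative by \<open>SOME\<close>, which no program ever evaluates.\<close>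

definition representative :: "table \<Rightarrow> cgraph \<Rightarrow> cgraph" where
  "representative T G = (if \<exists>p\<in>set T. isomorphic G (fst p)
    then snd (SOME p. p \<in> set T \<and> isomorphic G (fst p))
    else (SOME H. simple_graph H \<and> isomorphic G H))"

definition table_invariant :: "table \<Rightarrow> cgraph \<Rightarrow> data" where
  "table_invariant T G = enc_cgraph (representative T G)"

section \<open>Tables induce complete invariants\<close>

lemma representative:
  assumes "valid_table T" "simple_graph G"
  shows "simple_graph (representative T G) \<and> isomorphic G (representative T G)"
proof (cases "\<exists>p\<in>set T. isomorphic G (fst p)")
  case True
  define p where "p = (SOME p. p \<in> set T \<and> isomorphic G (fst p))"
  have "p \<in> set T \<and> isomorphic G (fst p)"
    unfolding p_def by (rule someI_ex) (use True in blast)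
  then show ?thesis
    using assms(1) True isomorphic_trans[of G "fst p" "snd p"]
    by (simp add: representative_def valid_table_def flip: p_def)
next
  case False
  have "simple_graph (SOME H. simple_graph H \<and> isomorphic G H) \<and>
      isomorphic G (SOME H. simple_graph H \<and> isomorphic G H)"
    by (rule someI[of _ G]) (simp add: assms(2) isomorphic_refl)
  then show ?thesis using False by (simp add: representative_def)
qed

text \<open>\<open>G\<close> enters the definition only through the predicate of being isomorphic to
  it, so even the arbitrary choices coincide.\<close>

lemma representative_cong:
  assumes "isomorphic G H"
  shows "representative T G = representative T H"
proof -
  have "isomorphic G K \<longleftrightarrow> isomorphic H K" for K
    using assms isomorphic_sym isomorphic_trans by blast
  then show ?thesis by (simp add: representative_def)
qed

lemma complete_table_invariant:
  assumes "valid_table T"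
  shows "complete_invariant (table_invariant T)"
  unfolding complete_invariant_def
proof (intro allI impI iffI)
  fix G H :: cgraph assume s: "simple_graph G" "simple_graph H"
  assume "table_invariant T G = table_invariant T H"
  \<comment> \<open>Codes ignore colors outside the vertex set, so equal codes give isomorphic
    rather than equal representatives.\<close>
  then have "isomorphic (representative T G) (representative T H)"
    using representative[OF assms] s by (intro enc_cgraph_isomorphic) (auto simp: table_invariant_def)
  then show "isomorphic G H"
    using representative[OF assms s(1)] representative[OF assms s(2)]
    by (meson isomorphic_sym isomorphic_trans)
next
  fix G H :: cgraph assume "isomorphic G H"
  then show "table_invariant T G = table_invariant T H"
    unfolding table_invariant_def using representative_cong by metis
qed

text \<open>The definition searches up to isomorphism, while a program compares codes. For a graph
  listed in the table both find an entry of the same class, and validity makes the representatives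
  equal.\<close>

lemma table_invariant_lookup:
  assumes "valid_table T" "G \<in> fst ` set T"
  defines "l \<equiv> filter (\<lambda>p. enc_cgraph (fst p) = enc_cgraph G) T"
  shows "l \<noteq> [] \<and> table_invariant T G = enc_cgraph (snd (hd l))"
proof -
  from assms(2) have l: "l \<noteq> []" by (auto simp: l_def filter_empty_conv)
  then have h: "hd l \<in> set T" "enc_cgraph (fst (hd l)) = enc_cgraph G"
    using hd_in_set[OF l] by (auto simp: l_def)
  have "simple_graph G" "simple_graph (fst (hd l))"
    using assms(1,2) h(1) by (auto simp: valid_table_def)
  then have iso: "isomorphic G (fst (hd l))"
    using h(2) enc_cgraph_isomorphic by metis
  define p where "p = (SOME p. p \<in> set T \<and> isomorphic G (fst p))"
  have p: "p \<in> set T \<and> isomorphic G (fst p)"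
    unfolding p_def by (rule someI[of _ "hd l"]) (use h iso in simp)
  have "isomorphic (fst p) (fst (hd l))"
    using p iso isomorphic_sym isomorphic_trans by blast
  then have "snd p = snd (hd l)"
    using assms(1) p h(1) unfolding valid_table_def by blast
  moreover have "representative T G = snd p"
    unfolding representative_def p_def using h(1) iso by auto
  ultimately show ?thesis using l by (simp add: table_invariant_def)
qed

text \<open>The first listed member of a class represents it, so representatives are never larger
  than the listed graphs.\<close>

definition add_entry :: "cgraph \<Rightarrow> table \<Rightarrow> table" where
  "add_entry G T = (G, if filter (\<lambda>p. isomorphic (fst p) G) T = [] then G
    else snd (hd (filter (\<lambda>p. isomorphic (fst p) G) T))) # T"

lemma valid_table_Cons:
  assumes T: "valid_table T" and GH: "simple_graph G" "simple_graph H" "isomorphic G H"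
    and eq: "\<And>p. p \<in> set T \<Longrightarrow> isomorphic (fst p) G \<Longrightarrow> snd p = H"
  shows "valid_table ((G, H) # T)"
  unfolding valid_table_def
proof (intro conjI ballI impI)
  fix p q assume pq: "p \<in> set ((G, H) # T)" "q \<in> set ((G, H) # T)" "isomorphic (fst p) (fst q)"
  show "snd p = snd q"
  proof (cases "p \<in> set T \<and> q \<in> set T")
    case True
    then show ?thesis using T pq(3) unfolding valid_table_def by blast
  next
    case False
    then consider "p = (G, H)" "q = (G, H)" | "p = (G, H)" "q \<in> set T" | "q = (G, H)" "p \<in> set T"
      using pq by auto
    then show ?thesis
      using eq[of p] eq[of q] pq(3) isomorphic_sym[OF pq(3)] by cases simp_all
  qed
qed (use T GH in \<open>auto simp: valid_table_def\<close>)

lemma valid_add_entry: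
  assumes "valid_table T" "simple_graph G"
  shows "valid_table (add_entry G T) \<and> snd ` set (add_entry G T) \<subseteq> insert G (snd ` set T)"
proof (cases "filter (\<lambda>p. isomorphic (fst p) G) T = []")
  case True
  then have "\<not> isomorphic (fst p) G" if "p \<in> set T" for p
    using that by (simp add: filter_empty_conv)
  then have "valid_table ((G, G) # T)"
    by (intro valid_table_Cons assms isomorphic_refl) simp
  moreover have "add_entry G T = (G, G) # T" using True by (simp add: add_entry_def)
  ultimately show ?thesis by auto
next
  case False
  define p where "p = hd (filter (\<lambda>p. isomorphic (fst p) G) T)"
  have p: "p \<in> set T" "isomorphic (fst p) G"
    using hd_in_set[OF False] by (auto simp: p_def)
  have "snd q = snd p" if "q \<in> set T" "isomorphic (fst q) G" for q
    using isomorphic_trans[OF that(2) isomorphic_sym[OF p(2)]] assms(1) p(1) that(1)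
    unfolding valid_table_def by blast
  moreover have "simple_graph (snd p)" "isomorphic (fst p) (snd p)"
    using assms(1) p(1) unfolding valid_table_def by blast+
  ultimately have "valid_table ((G, snd p) # T)"
    using isomorphic_trans[OF isomorphic_sym[OF p(2)]] by (intro valid_table_Cons assms) simp_all
  moreover have "add_entry G T = (G, snd p) # T" using False by (simp add: add_entry_def p_def)
  ultimately show ?thesis using p(1) by auto
qed

text \<open>Entries appear in reverse because each is put in front. That representatives are taken
  from \<open>Gs\<close> later bounds the size of the table.\<close>

lemma valid_table_fold:
  assumes "\<And>G. G \<in> set Gs \<Longrightarrow> simple_graph G"
  shows "valid_table (fold add_entry Gs []) \<and> map fst (fold add_entry Gs []) = rev Gs \<and>
    snd ` set (fold add_entry Gs []) \<subseteq> set Gs"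
  using assms
proof (induction Gs rule: rev_induct)
  case (snoc G Gs)
  then have IH: "valid_table (fold add_entry Gs [])" "map fst (fold add_entry Gs []) = rev Gs"
    "snd ` set (fold add_entry Gs []) \<subseteq> set Gs" by simp_all
  have "map fst (add_entry G T) = G # map fst T" for T by (simp add: add_entry_def)
  moreover have "simple_graph G" using snoc.prems by simp
  note v = valid_add_entry[OF IH(1) this]
  moreover have "snd ` set (add_entry G (fold add_entry Gs [])) \<subseteq> insert G (set Gs)"
    by (rule subset_trans[OF conjunct2[OF v] insert_mono[OF IH(3)]])
  ultimately show ?case using IH(2) by simp
qed (simp add: valid_table_def)

section \<open>One level of the recursion, and building the table\<close>

locale reversible_decomposition = polytime_decomposition +
  assumes simple_quotient: "simple_wrt C \<M> R"
    and reversible_quotient: "reversible C \<M> R"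
    and ptime_prime_iso: "poly_time_isomorphism {G \<in> colored C. prime_wrt \<M> G}"
begin

text \<open>All modules are taken, trivial ones included, because the quotient color of every vertex
  in a module mentions the invariant of that module. Prime graphs are compared directly.\<close>

definition children :: "cgraph \<Rightarrow> cgraph list" where
  "children G = (if prime_wrt \<M> G then [] else map (induced G) (listing (enc_set enc_nat) (\<M> G)))"

text \<open>Lets a prime graph and one that is not prime be declared non-isomorphic at once, so that
  the two graphs of any remaining pair are treated alike.\<close>

lemma prime_isomorphic:
  assumes "isomorphic G H" "G \<in> colored C" "H \<in> colored C" "prime_wrt \<M> G"
  shows "prime_wrt \<M> H"
proof -
  obtain \<phi> where \<phi>: "is_iso \<phi> G H" using assms(1) by (auto simp: isomorphic_def)
  then have "\<M> H = (\<lambda>A. \<phi> ` A) ` \<M> G"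
    using functor_\<M> assms(2,3) unfolding decomposition_functor_def by blast
  then show ?thesis
    using assms(4) nontrivial_iso[OF \<phi> module_subset[OF assms(2)]] unfolding prime_wrt_def by auto
qed

lemma set_listing_modules: "G \<in> colored C \<Longrightarrow> set (listing (enc_set enc_nat) (\<M> G)) = \<M> G"
  by (intro set_listing modules_finite inj_on_enc_set_nat module_finite)

lemma set_children:
  "G \<in> colored C \<Longrightarrow> set (children G) = (if prime_wrt \<M> G then {} else induced G ` \<M> G)"
  by (simp add: children_def set_listing_modules)

lemma children_colored:
  assumes "G \<in> colored C" "H \<in> set (children G)"
  shows "H \<in> colored C \<and> dsize (enc_cgraph H) \<le> dsize (enc_cgraph G)"
proof -
  from assms obtain A where A: "A \<in> \<M> G" "H = induced G A"
    by (auto simp: set_children split: if_splits)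
  note sub = module_subset[OF assms(1) A(1)]
  show ?thesis
    using colored_induced[OF assms(1) sub] dsize_induced_le[OF colored_simple[OF assms(1)] sub] A(2)
    by simp
qed

text \<open>Potential of the worklist. It decreases because the modules of a graph that is not prime are
  non-empty, disjoint and proper subsets of its \<open>n\<close> vertices, so that
  \<open>\<Sum>(a\<^sup>2 + 1) \<le> \<Sum>a (a + 1) \<le> \<Sum>a n \<le> n\<^sup>2\<close> for their sizes \<open>a\<close>.\<close>

definition weight :: "cgraph \<Rightarrow> nat" where
  "weight G = (card (verts G))\<^sup>2 + 1"

lemma weight_children:
  assumes "G \<in> colored C"
  shows "(\<Sum>H\<leftarrow>children G. weight H) < weight G"
proof (cases "prime_wrt \<M> G")
  case True
  then show ?thesis by (simp add: children_def weight_def)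
next
  case False
  let ?n = "card (verts G)"
  have finV: "finite (verts G)" by (rule simple_graph_finite[OF colored_simple[OF assms]])
  from False obtain B where B: "B \<in> \<M> G" "B \<noteq> verts G" "B \<noteq> {}"
    by (auto simp: prime_wrt_def nontrivial_def)
  note part = modules_partition[OF assms]
  have disj: "pairwise disjnt (\<M> G)"
    using partition_onD2[OF part] by (simp add: disjoint_def pairwise_def disjnt_def)
  \<comment> \<open>If the whole vertex set were a module, it would meet the non-empty
    \<open>B\<close>, against disjointness. \<open>B\<close> itself is proper because
    \<open>nontrivial\<close> excludes the whole vertex set.\<close>
  have mod: "A \<noteq> {} \<and> A \<subset> verts G" if A: "A \<in> \<M> G" for A
  proof -
    have sub: "A \<subseteq> verts G" "B \<subseteq> verts G" using module_subset[OF assms] A B by auto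
    have "A \<noteq> verts G"
    proof
      assume "A = verts G"
      then have "\<not> disjnt A B" "A \<noteq> B" using B sub by (auto simp: disjnt_def)
      then show False using disj A B(1) by (auto simp: pairwise_def)
    qed
    then show ?thesis using sub partition_onD3[OF part] A by auto
  qed
  have "(\<Sum>H\<leftarrow>children G. weight H) = (\<Sum>A\<leftarrow>listing (enc_set enc_nat) (\<M> G). (card A)\<^sup>2 + 1)"
    using False by (simp add: children_def weight_def o_def)
  also have "\<dots> = (\<Sum>A\<in>\<M> G. (card A)\<^sup>2 + 1)"
    using sum.distinct_set_conv_list[OF distinct_listing[OF modules_finite[OF assms]],
        of "\<lambda>A. (card A)\<^sup>2 + 1" "enc_set enc_nat"] set_listing_modules[OF assms] by simp
  also have "\<dots> \<le> (\<Sum>A\<in>\<M> G. card A * ?n)"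
  proof (rule sum_mono)
    fix A assume A: "A \<in> \<M> G"
    have "1 \<le> card A" using mod[OF A] finV finite_subset by (simp add: Suc_le_eq card_gt_0_iff psubset_eq) blast
    moreover have "card A < ?n" using mod[OF A] psubset_card_mono[OF finV] by blast
    then have "card A * Suc (card A) \<le> card A * ?n" by (intro mult_left_mono) auto
    ultimately show "(card A)\<^sup>2 + 1 \<le> card A * ?n" by (simp add: power2_eq_square)
  qed
  also have "\<dots> = card (\<Union>(\<M> G)) * ?n"
    using card_Union_disjoint[OF disj] module_finite[OF assms] by (simp add: sum_distrib_right)
  also have "\<dots> \<le> ?n * ?n"
    using module_subset[OF assms] by (intro mult_right_mono card_mono finV) auto
  also have "\<dots> < weight G" by (simp add: weight_def power2_eq_square)
  finally show ?thesis .
qed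

lemma ptime_children:
  assumes "ptime D i (\<lambda>x. enc_cgraph (G x))" "\<And>x. x \<in> D \<Longrightarrow> G x \<in> colored C"
  shows "ptime D i (\<lambda>x. enc_list (map enc_cgraph (children (G x))))"
proof -
  let ?l = "\<lambda>x. listing (enc_set enc_nat) (\<M> (G x))"
  have 1: "ptime D i (\<lambda>x. enc_list (map (enc_set enc_nat) (?l x)))"
    by (rule ptime_cong[OF ptime_modules[OF assms]]) (simp_all add: assms(2) modules_finite enc_set_listing)
  have "ptime (SIGMA x:D. set (?l x)) (extend i (\<lambda>_. enc_set enc_nat))
      (\<lambda>p. enc_cgraph (induced (G (fst p)) (snd p)))"
    by (rule ptime_induced[OF ptime_weaken[OF assms(1)] _ ptime_snd])
      (auto simp: set_listing_modules[OF assms(2)] intro: colored_simple[OF assms(2)] subsetD[OF module_subset[OF assms(2)]])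
  from ptime_map[OF 1 this]
  have "ptime D i (\<lambda>x. enc_list (map (\<lambda>A. enc_cgraph (induced (G x) A)) (?l x)))" .
  from ptime_If[OF ptime_prime[OF assms] ptime_const[of _ _ Atom] ptime_restrict[OF this]]
  show ?thesis by (rule ptime_cong) (simp_all add: children_def o_def)
qed

lemma ptime_table_invariant:
  assumes G: "ptime D i (\<lambda>x. enc_cgraph (G x))"
    and T: "ptime D i (\<lambda>x. enc_list (map enc_entry (T x)))"
    and "\<And>x. x \<in> D \<Longrightarrow> valid_table (T x)" "\<And>x. x \<in> D \<Longrightarrow> G x \<in> fst ` set (T x)"
  shows "ptime D i (\<lambda>x. table_invariant (T x) (G x))"
proof -
  note lookup = table_invariant_lookup[OF assms(3,4)]
  let ?l = "\<lambda>x. filter (\<lambda>p. enc_cgraph (fst p) = enc_cgraph (G x)) (T x)"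
  let ?E = "SIGMA x:D. set (T x)"
  have "ptime ?E (extend i (\<lambda>_. enc_entry)) (\<lambda>p. enc_cgraph (fst (snd p)))"
    using ptime_left[OF ptime_snd, of ?E "\<lambda>p. i (fst p)" "\<lambda>p. enc_entry (snd p)"]
    by (simp add: enc_entry_def)
  from ptime_eq[OF this ptime_weaken[OF G]]
  have "ptime D i (\<lambda>x. enc_list (map enc_entry (?l x)))"
    by - (rule ptime_filter[OF T], assumption)
  from ptime_right[OF ptime_hd[OF this]]
  have "ptime D i (\<lambda>x. enc_cgraph (snd (hd (?l x))))"
    using lookup by (simp add: enc_entry_def)
  then show ?thesis by (rule ptime_cong) (simp_all add: lookup)
qed

lemma ptime_prime_isomorphic:
  assumes "ptime D i (\<lambda>x. enc_cgraph (G x))" "ptime D i (\<lambda>x. enc_cgraph (H x))"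
    and "\<And>x. x \<in> D \<Longrightarrow> G x \<in> colored C \<and> prime_wrt \<M> (G x)"
    and "\<And>x. x \<in> D \<Longrightarrow> H x \<in> colored C \<and> prime_wrt \<M> (H x)"
  shows "ptime D i (\<lambda>x. enc_bool (isomorphic (G x) (H x)))"
proof -
  let ?K = "{G \<in> colored C. prime_wrt \<M> G}"
  have 1: "ptime (?K \<times> ?K) (\<lambda>p. Pair (enc_cgraph (fst p)) (enc_cgraph (snd p)))
      (\<lambda>p. enc_bool (isomorphic (fst p) (snd p)))"
    using ptime_prime_iso
    unfolding poly_time_isomorphism_def poly_time_computable_def ptime_def enc_prod_def case_prod_beta
    by simp
  have "ptime D i (\<lambda>x. Pair (enc_cgraph (fst (G x, H x))) (enc_cgraph (snd (G x, H x))))"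
    using ptime_pair[OF assms(1,2)] by simp
  from ptime_call[OF 1 this] show ?thesis using assms(3,4) by simp
qed

text \<open>A quotient is a recolored induced subgraph, and membership ignores colors. Hence
  heredity makes the test for prime graphs applicable to quotients.\<close>

lemma quotient_colored:
  assumes "G \<in> colored C"
  shows "quotient \<M> R I G \<in> colored C"
proof -
  have "induced G (quotient_verts \<M> R G) \<in> colored C"
    by (rule colored_induced[OF assms]) (auto simp: quotient_verts_def)
  then show ?thesis by (simp add: colored_def quotient_def graph.truncate_def)
qed

text \<open>One level of the recursion without a recursive call: the table supplies the invariants
  of the children. Both quotients are colored from the same table, since reversibility compares
  quotients under a common invariant.\<close>

lemma ptime_isomorphic:
  assumes G: "ptime D i (\<lambda>x. enc_cgraph (G x))" "\<And>x. x \<in> D \<Longrightarrow> G x \<in> colored C"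
    and H: "ptime D i (\<lambda>x. enc_cgraph (H x))" "\<And>x. x \<in> D \<Longrightarrow> H x \<in> colored C"
    and T: "ptime D i (\<lambda>x. enc_list (map enc_entry (T x)))" "\<And>x. x \<in> D \<Longrightarrow> valid_table (T x)"
    and TG: "\<And>x. x \<in> D \<Longrightarrow> set (children (G x)) \<subseteq> fst ` set (T x)"
    and TH: "\<And>x. x \<in> D \<Longrightarrow> set (children (H x)) \<subseteq> fst ` set (T x)"
  shows "ptime D i (\<lambda>x. enc_bool (isomorphic (G x) (H x)))"
proof -
  let ?Q = "\<lambda>G x. quotient \<M> R (table_invariant (T x)) (G x)"
  let ?prime = "\<lambda>x. prime_wrt \<M> (G x)"
  let ?D = "{x \<in> D. ?prime x = prime_wrt \<M> (H x)}"
  let ?N = "{x \<in> ?D. \<not> ?prime x}"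
  have Q: "ptime ?N i (\<lambda>x. enc_cgraph (?Q K x))"
    if K: "ptime D i (\<lambda>x. enc_cgraph (K x))" "\<And>x. x \<in> D \<Longrightarrow> K x \<in> colored C"
      and TK: "\<And>x. x \<in> D \<Longrightarrow> set (children (K x)) \<subseteq> fst ` set (T x)"
      and prime: "\<And>x. x \<in> ?N \<Longrightarrow> \<not> prime_wrt \<M> (K x)" for K
  proof (rule ptime_quotient)
    show KN: "ptime ?N i (\<lambda>x. enc_cgraph (K x))" by (intro ptime_restrict K)
    show "x \<in> ?N \<Longrightarrow> K x \<in> colored C" for x using K by simp
    have TN: "ptime ?N i (\<lambda>x. enc_list (map enc_entry (T x)))" by (intro ptime_restrict T)
    show "ptime (SIGMA x:?N. \<M> (K x)) (extend i (\<lambda>_. enc_set enc_nat))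
        (\<lambda>p. table_invariant (T (fst p)) (induced (K (fst p)) (snd p)))"
    proof (rule ptime_table_invariant[OF ptime_induced[OF ptime_weaken[OF KN] _ ptime_snd] ptime_weaken[OF TN]])
      fix p assume p: "p \<in> (SIGMA x:?N. \<M> (K x))"
      then have x: "fst p \<in> D" "fst p \<in> ?N" "snd p \<in> \<M> (K (fst p))" by auto
      show "simple_graph (K (fst p))" using K(2)[OF x(1)] by (rule colored_simple)
      show "snd p \<subseteq> verts (K (fst p))" using K(2)[OF x(1)] x(3) by (rule module_subset)
      show "valid_table (T (fst p))" using T(2)[OF x(1)] .
      \<comment> \<open>For a graph that is not prime every module yields a child, so the lookup
        succeeds.\<close>
      have "induced (K (fst p)) (snd p) \<in> set (children (K (fst p)))"
        using prime[OF x(2)] x(3) by (simp add: set_children[OF K(2)[OF x(1)]])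
      then show "induced (K (fst p)) (snd p) \<in> fst ` set (T (fst p))" using TK[OF x(1)] by blast
    qed
  qed
  have prime_quotient: "?Q K x \<in> colored C \<and> prime_wrt \<M> (?Q K x)"
    if "x \<in> D" "K x \<in> colored C" for K x
    using that simple_quotient quotient_colored complete_table_invariant[OF T(2)]
    unfolding simple_wrt_def by blast
  have b: "ptime ?N i (\<lambda>x. enc_bool (isomorphic (?Q G x) (?Q H x)))"
    by (rule ptime_prime_isomorphic[OF Q[OF G TG] Q[OF H TH]])
      (use G(2) H(2) prime_quotient in auto)
  have a: "ptime {x \<in> ?D. ?prime x} i (\<lambda>x. enc_bool (isomorphic (G x) (H x)))"
    by (rule ptime_prime_isomorphic) (use G H in \<open>auto intro: ptime_restrict\<close>)
  note same = ptime_If[OF ptime_restrict[OF ptime_prime[OF G]] a b]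
  from ptime_If[OF ptime_iff[OF ptime_prime[OF G] ptime_prime[OF H]] same ptime_const[of _ _ "enc_bool False"]]
  show ?thesis
  proof (rule ptime_cong)
    fix x assume x: "x \<in> D"
    note GH = G(2)[OF x] H(2)[OF x]
    have "isomorphic (G x) (H x) \<longleftrightarrow> isomorphic (?Q G x) (?Q H x)"
      using reversible_quotient GH complete_table_invariant[OF T(2)[OF x]]
      unfolding reversible_def by blast
    moreover have "isomorphic (G x) (H x) \<Longrightarrow> ?prime x = prime_wrt \<M> (H x)"
      using prime_isomorphic GH isomorphic_sym by blast
    ultimately show "(if ?prime x = prime_wrt \<M> (H x) then if ?prime x then enc_bool (isomorphic (G x) (H x))
        else enc_bool (isomorphic (?Q G x) (?Q H x)) else enc_bool False) =
        enc_bool (isomorphic (G x) (H x))"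
      by auto
  qed simp_all
qed

text \<open>When \<open>G\<close> is added, the table lists its children and, by the same closure,
  those of every earlier graph. Hence \<open>G\<close> can be compared with all earlier graphs by
  \<open>ptime_isomorphic\<close>, a single program used with growing tables.\<close>

lemma ptime_table:
  assumes Gs: "ptime D i (\<lambda>x. enc_list (map enc_cgraph (Gs x)))"
    and col: "\<And>x. x \<in> D \<Longrightarrow> set (Gs x) \<subseteq> colored C"
    and closed: "\<And>x us G vs. x \<in> D \<Longrightarrow> Gs x = us @ G # vs \<Longrightarrow> set (children G) \<subseteq> set us"
  shows "ptime D i (\<lambda>x. enc_list (map enc_entry (fold add_entry (Gs x) [])))"
proof -
  obtain r where r: "\<And>x. x \<in> D \<Longrightarrow> dsize (enc_list (map enc_cgraph (Gs x))) \<le> poly r (dsize (i x))"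
    using ptime_dsize[OF Gs] by blast
  have table: "valid_table (fold add_entry us []) \<and> map fst (fold add_entry us []) = rev us \<and>
      snd ` set (fold add_entry us []) \<subseteq> set us" if "x \<in> D" "Gs x = us @ vs" for x us vs
    by (rule valid_table_fold) (use col[OF that(1)] that(2) in \<open>auto intro: colored_simple\<close>)
  show ?thesis
  \<comment> \<open>At most \<open>r\<close> entries, each consisting of two graphs of size at most
    \<open>r\<close>, with one unit for the pair and one for the list cell.\<close>
  proof (rule ptime_fold[where e = "\<lambda>_. enc_cgraph" and ea = "\<lambda>_ T. enc_list (map enc_entry T)"
        and f = "\<lambda>_. add_entry" and z = "\<lambda>_. []" and q = "1 + r * (2 + 2 * r)"])
    let ?E = "{(x, G, T). x \<in> D \<and> (\<exists>us vs. Gs x = us @ G # vs \<and> T = fold add_entry us [])}"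
    let ?i = "\<lambda>p. Pair (i (fst p)) (Pair (enc_cgraph (fst (snd p))) (enc_list (map enc_entry (snd (snd p)))))"
    have E: "fst (snd p) \<in> colored C \<and> valid_table (snd (snd p)) \<and>
        set (children (fst (snd p))) \<subseteq> fst ` set (snd (snd p)) \<and>
        (\<forall>H\<in>fst ` set (snd (snd p)). H \<in> colored C \<and> set (children H) \<subseteq> fst ` set (snd (snd p)))"
      if "p \<in> ?E" for p
    proof -
      obtain x G T where p: "p = (x, G, T)" by (cases p)
      with that obtain us vs where x: "x \<in> D" "Gs x = us @ G # vs" and T: "T = fold add_entry us []"
        by auto
      have t: "valid_table T" "map fst T = rev us" using table[OF x] T by auto
      then have fst: "fst ` set T = set us" by (metis list.set_map set_rev)
      have "set (children H) \<subseteq> set us" if H: "H \<in> set us" for H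
      proof -
        obtain as bs where us: "us = as @ H # bs" using split_list[OF H] by blast
        then have "set (children H) \<subseteq> set as" using closed[OF x(1), of as H "bs @ G # vs"] x(2) by simp
        then show ?thesis using us by auto
      qed
      moreover have "set us \<subseteq> colored C" "G \<in> colored C" using col[OF x(1)] x(2) by auto
      ultimately show ?thesis using t(1) closed[OF x] unfolding p fst_conv snd_conv fst by blast
    qed
    have G: "ptime ?E ?i (\<lambda>p. enc_cgraph (fst (snd p)))"
      and T: "ptime ?E ?i (\<lambda>p. enc_list (map enc_entry (snd (snd p))))"
      using ptime_left[OF ptime_right[OF ptime_refl[of ?E ?i]]]
        ptime_right[OF ptime_right[OF ptime_refl[of ?E ?i]]] by simp_all
    let ?F = "SIGMA p:?E. set (snd (snd p))"
    let ?l = "\<lambda>p. filter (\<lambda>q. isomorphic (fst q) (fst (snd p))) (snd (snd p))"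
    have "ptime ?F (extend ?i (\<lambda>_. enc_entry)) (\<lambda>q. enc_cgraph (fst (snd q)))"
      using ptime_left[OF ptime_snd, of ?F "\<lambda>q. ?i (fst q)" "\<lambda>q. enc_entry (snd q)"]
      by (simp add: enc_entry_def)
    then have "ptime ?F (extend ?i (\<lambda>_. enc_entry))
        (\<lambda>q. enc_bool (isomorphic (fst (snd q)) (fst (snd (fst q)))))"
    proof (rule ptime_isomorphic[OF _ _ ptime_weaken[OF G] _ ptime_weaken[OF T]])
      fix q assume "q \<in> ?F"
      then have "(fst q, snd q) \<in> ?F" by (simp only: prod.collapse)
      note q = SigmaD1[OF this] SigmaD2[OF this]
      show "fst (snd q) \<in> colored C" "fst (snd (fst q)) \<in> colored C" "valid_table (snd (snd (fst q)))"
        "set (children (fst (snd q))) \<subseteq> fst ` set (snd (snd (fst q)))"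
        "set (children (fst (snd (fst q)))) \<subseteq> fst ` set (snd (snd (fst q)))"
        using E[OF q(1)] q(2) by blast+
    qed
    then have l: "ptime ?E ?i (\<lambda>p. enc_list (map enc_entry (?l p)))"
      by - (rule ptime_filter[OF T], assumption)
    have "ptime ?E ?i (\<lambda>p. enc_bool (enc_list (map enc_entry (?l p)) = Atom))"
      by (rule ptime_eq[OF l ptime_const])
    then have empty: "ptime ?E ?i (\<lambda>p. enc_bool (?l p = []))" by simp
    have "ptime {p \<in> ?E. \<not> ?l p = []} ?i (\<lambda>p. right (enc_entry (hd (?l p))))"
      by (rule ptime_right[OF ptime_hd[OF ptime_restrict[OF l]]]) simp
    then have "ptime {p \<in> ?E. \<not> ?l p = []} ?i (\<lambda>p. enc_cgraph (snd (hd (?l p))))"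
      by (simp add: enc_entry_def)
    note rep = ptime_If[OF empty ptime_restrict[OF G] this]
    show "ptime ?E ?i (\<lambda>p. enc_list (map enc_entry (add_entry (fst (snd p)) (snd (snd p)))))"
      by (rule ptime_cong[OF ptime_pair[OF ptime_pair[OF G rep] T]])
        (simp_all add: add_entry_def enc_entry_def)
  next
    fix x us vs assume x: "x \<in> D" "Gs x = us @ vs"
    let ?T = "fold add_entry us []" and ?n = "poly r (dsize (i x))"
    have t: "map fst ?T = rev us" "snd ` set ?T \<subseteq> set us" using table[OF x] by auto
    have size: "dsize (enc_cgraph G) \<le> ?n" if "G \<in> set us" for G
    proof -
      have "enc_cgraph G \<in> set (map enc_cgraph (Gs x))" using that x(2) by simp
      then show ?thesis using dsize_mem_le r[OF x(1)] le_trans by blast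
    qed
    have "dsize (enc_entry p) \<le> 1 + 2 * ?n" if p: "p \<in> set ?T" for p
    proof -
      have "fst p \<in> set (map fst ?T)" using p by simp
      then have "fst p \<in> set us" unfolding t(1) by simp
      moreover have "snd p \<in> set us" using t(2) p by blast
      ultimately show ?thesis using size[of "fst p"] size[of "snd p"] by (simp add: enc_entry_def)
    qed
    then have "dsize (enc_list (map enc_entry ?T)) \<le> 1 + length (map enc_entry ?T) * (1 + (1 + 2 * ?n))"
      by (intro dsize_enc_list_le) auto
    also have "\<dots> \<le> 1 + ?n * (1 + (1 + 2 * ?n))"
    proof -
      have "length ?T = length us" using arg_cong[OF t(1), of length] by simp
      also have "\<dots> \<le> length (map enc_cgraph (Gs x))" using x(2) by simp
      also have "\<dots> \<le> ?n" using length_le_dsize r[OF x(1)] le_trans by blast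
      finally show ?thesis by (intro add_left_mono mult_right_mono) simp_all
    qed
    finally show "dsize (enc_list (map enc_entry ?T)) \<le> poly (1 + r * (2 + 2 * r)) (dsize (i x))"
      by simp
  qed (use Gs ptime_const[of D i Atom] in simp_all)
qed

section \<open>Collecting the graphs of the recursion with a worklist\<close>

definition input :: "cgraph \<times> cgraph \<Rightarrow> data" where
  "input x = Pair (enc_cgraph (fst x)) (enc_cgraph (snd x))"

text \<open>The worklist stands on the left, where \<open>ptime_while\<close> looks for the end of
  the loop; the input is kept for the final comparison.\<close>

definition enc_state :: "cgraph \<times> cgraph \<Rightarrow> cgraph list \<times> cgraph list \<Rightarrow> data" where
  "enc_state x s = Pair (enc_list (map enc_cgraph (fst s)))
    (Pair (enc_list (map enc_cgraph (snd s))) (input x))"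

text \<open>States of the search for all graphs needed in the recursion: graphs still to be expanded and
  graphs already expanded, the latter with children in front of their parents.\<close>

definition states :: "cgraph \<times> cgraph \<Rightarrow> (cgraph list \<times> cgraph list) set" where
  "states x = {(us, vs).
    (\<forall>G\<in>set us \<union> set vs. G \<in> colored C \<and> dsize (enc_cgraph G) \<le> dsize (input x)) \<and>
    length vs + (\<Sum>G\<leftarrow>us. weight G) \<le> weight (fst x) + weight (snd x) \<and>
    {fst x, snd x} \<subseteq> set us \<union> set vs \<and>
    (\<forall>as G bs. vs = as @ G # bs \<longrightarrow> set (children G) \<subseteq> set us \<union> set as)}"

definition expand :: "cgraph list \<times> cgraph list \<Rightarrow> cgraph list \<times> cgraph list" where
  "expand s = (children (hd (fst s)) @ tl (fst s), hd (fst s) # snd s)"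

lemma weight_le:
  assumes "simple_graph G" "dsize (enc_cgraph G) \<le> n"
  shows "weight G \<le> n\<^sup>2 + 1"
  unfolding weight_def using card_verts_le_dsize[OF assms(1)] assms(2) by (simp add: power_mono)

lemma length_le_weight: "length us \<le> (\<Sum>G\<leftarrow>us. weight G)"
  by (induction us) (auto simp: weight_def)

text \<open>An expansion adds one graph to \<open>vs\<close> and lowers the total weight of the
  worklist by at least one, so the sum of both never grows. This bounds the number of graphs
  although duplicates are kept.\<close>

lemma expand_states:
  assumes "(G # us, vs) \<in> states x"
  shows "expand (G # us, vs) \<in> states x"
    and "(\<Sum>H\<leftarrow>children G @ us. weight H) < (\<Sum>H\<leftarrow>G # us. weight H)"
proof -
  have G: "G \<in> colored C" "dsize (enc_cgraph G) \<le> dsize (input x)"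
    using assms by (auto simp: states_def)
  show less: "(\<Sum>H\<leftarrow>children G @ us. weight H) < (\<Sum>H\<leftarrow>G # us. weight H)"
    using weight_children[OF G(1)] by simp
  have "H \<in> colored C \<and> dsize (enc_cgraph H) \<le> dsize (input x)" if "H \<in> set (children G)" for H
    using children_colored[OF G(1) that] G(2) by auto
  moreover note s = assms[unfolded states_def mem_Collect_eq prod.case]
  ultimately have "\<forall>H\<in>set (children G @ us) \<union> set (G # vs).
      H \<in> colored C \<and> dsize (enc_cgraph H) \<le> dsize (input x)" by auto
  moreover have "length (G # vs) + (\<Sum>H\<leftarrow>children G @ us. weight H) \<le> weight (fst x) + weight (snd x)"
    using s less by simp
  moreover have "{fst x, snd x} \<subseteq> set (children G @ us) \<union> set (G # vs)"
    using s by auto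
  \<comment> \<open>\<open>G\<close> leaves the worklist and becomes the head of the second list, so
    a parent that waited for it finds it in front; the children of \<open>G\<close> itself are now
    in the worklist.\<close>
  moreover have "set (children H) \<subseteq> set (children G @ us) \<union> set as"
    if eq: "G # vs = as @ H # bs" for as H bs
  proof (cases as)
    case (Cons a as')
    then have "set (children H) \<subseteq> insert G (set us) \<union> set as'" "a = G"
      using s eq by auto
    then show ?thesis using Cons by auto
  qed (use eq in auto)
  ultimately show "expand (G # us, vs) \<in> states x"
    unfolding expand_def states_def fst_conv snd_conv list.sel mem_Collect_eq prod.case by blast
qed

text \<open>\<open>[:2, 0, 2:]\<close> is \<open>2 * (n^2 + 1)\<close>, a bound on the joint weight
  of the two inputs and hence on the lengths of both lists; \<open>[:1, 1:]\<close> is a list cell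
  with one graph.\<close>

lemma dsize_enc_state:
  assumes "fst x \<in> colored C" "snd x \<in> colored C" "s \<in> states x"
  shows "dsize (enc_state x s) \<le> poly (1 + (1 + [:2, 0, 2:] * [:1, 1:]) + (1 + (1 + [:2, 0, 2:] * [:1, 1:]) + [:0, 1:]))
    (dsize (input x))"
proof -
  let ?n = "dsize (input x)"
  obtain us vs where s: "s = (us, vs)" by (cases s)
  have "dsize (enc_cgraph (fst x)) \<le> ?n" "dsize (enc_cgraph (snd x)) \<le> ?n"
    by (simp_all add: input_def)
  then have "weight (fst x) + weight (snd x) \<le> (?n\<^sup>2 + 1) + (?n\<^sup>2 + 1)"
    by (intro add_mono weight_le colored_simple assms)
  then have len: "length us \<le> 2 + 2 * ?n\<^sup>2" "length vs \<le> 2 + 2 * ?n\<^sup>2"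
    using assms(3) length_le_weight[of us] by (auto simp: states_def s)
  have *: "dsize (enc_list (map enc_cgraph ws)) \<le> 1 + (2 + 2 * ?n\<^sup>2) * (1 + ?n)"
    if "ws = us \<or> ws = vs" for ws
  proof -
    have "dsize (enc_list (map enc_cgraph ws)) \<le> 1 + length (map enc_cgraph ws) * (1 + ?n)"
      by (rule dsize_enc_list_le) (use assms(3) that in \<open>auto simp: states_def s\<close>)
    also have "\<dots> \<le> 1 + (2 + 2 * ?n\<^sup>2) * (1 + ?n)"
      using len that by (intro add_left_mono mult_right_mono) auto
    finally show ?thesis .
  qed
  have "dsize (enc_state x s) = 1 + dsize (enc_list (map enc_cgraph us)) +
      (1 + dsize (enc_list (map enc_cgraph vs)) + ?n)"
    by (simp add: enc_state_def s)
  also have "\<dots> \<le> 1 + (1 + (2 + 2 * ?n\<^sup>2) * (1 + ?n)) + (1 + (1 + (2 + 2 * ?n\<^sup>2) * (1 + ?n)) + ?n)"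
    using *[OF disjI1[OF refl]] *[OF disjI2[OF refl]] by linarith
  finally show ?thesis by (simp add: power2_eq_square algebra_simps)
qed

lemma poly_time_isomorphism_colored: "poly_time_isomorphism (colored C)"
proof -
  let ?D = "colored C \<times> colored C"
  have "ptime ?D input (\<lambda>x. enc_bool (isomorphic (fst x) (snd x)))"
  proof (rule ptime_while[where e = enc_state and start = "\<lambda>x. ([fst x, snd x], [])" and S = states
        and f = "\<lambda>_. expand" and \<mu> = "\<lambda>_ s. \<Sum>G\<leftarrow>fst s. weight G" and r = "[:2, 0, 2:]"])
    have "ptime ?D input (\<lambda>x. enc_cgraph (fst x))" "ptime ?D input (\<lambda>x. enc_cgraph (snd x))"
      using ptime_left[OF ptime_refl[of ?D input]] ptime_right[OF ptime_refl[of ?D input]]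
      by (simp_all add: input_def)
    from ptime_pair[OF ptime_pair[OF this(1) ptime_pair[OF this(2) ptime_const[of _ _ Atom]]]
        ptime_pair[OF ptime_const[of _ _ Atom] ptime_refl]]
    show "ptime ?D input (\<lambda>x. enc_state x ([fst x, snd x], []))"
      by (simp add: enc_state_def)
    let ?i = "\<lambda>p. enc_state (fst p) (snd p)"
    let ?E = "{(x, s). x \<in> ?D \<and> s \<in> states x \<and> left (enc_state x s) \<noteq> Atom}"
    have E: "fst (snd p) \<noteq> [] \<and> hd (fst (snd p)) \<in> colored C" if "p \<in> ?E" for p
      using that by (cases "fst (snd p)") (auto simp: enc_state_def states_def)
    have us: "ptime ?E ?i (\<lambda>p. enc_list (map enc_cgraph (fst (snd p))))"
      and rest: "ptime ?E ?i (\<lambda>p. Pair (enc_list (map enc_cgraph (snd (snd p)))) (input (fst p)))"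
      using ptime_left[OF ptime_refl[of ?E ?i]] ptime_right[OF ptime_refl[of ?E ?i]]
      by (simp_all add: enc_state_def)
    have G: "ptime ?E ?i (\<lambda>p. enc_cgraph (hd (fst (snd p))))"
      by (rule ptime_hd[OF us]) (use E in blast)
    have "ptime ?E ?i (\<lambda>p. enc_list (map enc_cgraph (tl (fst (snd p)))))"
      by (rule ptime_cong[OF ptime_right[OF us]]) (simp_all add: right_enc_list map_tl)
    from ptime_append[OF ptime_children[OF G] this]
    have "ptime ?E ?i (\<lambda>p. enc_list (map enc_cgraph (fst (expand (snd p)))))"
      using E by (simp add: expand_def)
    from ptime_pair[OF this ptime_pair[OF ptime_pair[OF G ptime_left[OF rest]] ptime_right[OF rest]]]
    show "ptime ?E ?i (\<lambda>p. enc_state (fst p) (expand (snd p)))"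
      by (simp add: enc_state_def expand_def)
    let ?F = "{(x, s). x \<in> ?D \<and> s \<in> states x \<and> left (enc_state x s) = Atom}"
    let ?T = "\<lambda>p. fold add_entry (snd (snd p)) []"
    have vs: "ptime ?F ?i (\<lambda>p. enc_list (map enc_cgraph (snd (snd p))))"
      and inp: "ptime ?F ?i (\<lambda>p. input (fst p))"
      using ptime_left[OF ptime_right[OF ptime_refl[of ?F ?i]]]
        ptime_right[OF ptime_right[OF ptime_refl[of ?F ?i]]]
      by (simp_all add: enc_state_def)
    \<comment> \<open>Once the worklist is empty, children can only lie in front of their parents:
      the second list is closed under children and ordered as the construction of the table
      requires.\<close>
    have F: "fst (fst p) \<in> colored C \<and> snd (fst p) \<in> colored C \<and> set (snd (snd p)) \<subseteq> colored C \<and>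
        {fst (fst p), snd (fst p)} \<subseteq> set (snd (snd p)) \<and>
        (\<forall>as G bs. snd (snd p) = as @ G # bs \<longrightarrow> set (children G) \<subseteq> set as)" if "p \<in> ?F" for p
    proof -
      obtain x us vs where p: "p = (x, us, vs)" by (cases p)
      then have us: "us = []" using that by (simp add: enc_state_def)
      show ?thesis using that unfolding p us states_def by auto
    qed
    have T: "ptime ?F ?i (\<lambda>p. enc_list (map enc_entry (?T p)))"
    proof (rule ptime_table[OF vs])
      fix p assume p: "p \<in> ?F"
      from F[OF p] show "set (snd (snd p)) \<subseteq> colored C" by blast
      fix as G bs assume "snd (snd p) = as @ G # bs"
      with F[OF p] show "set (children G) \<subseteq> set as" by blast
    qed
    have table: "valid_table (?T p) \<and> fst ` set (?T p) = set (snd (snd p))" if "p \<in> ?F" for p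
    proof -
      have "simple_graph G" if "G \<in> set (snd (snd p))" for G
        using F[OF \<open>p \<in> ?F\<close>] that by (intro colored_simple) blast
      then have t: "valid_table (?T p)" "map fst (?T p) = rev (snd (snd p))"
        using valid_table_fold[of "snd (snd p)"] by simp_all
      from arg_cong[OF t(2), of set] t(1) show ?thesis by simp
    qed
    have sub: "set (children G) \<subseteq> fst ` set (?T p)" if p: "p \<in> ?F" and G: "G \<in> set (snd (snd p))" for p G
    proof -
      obtain as bs where eq: "snd (snd p) = as @ G # bs" using split_list[OF G] by blast
      then have "set (children G) \<subseteq> set as" using F[OF p] by blast
      then show ?thesis using table[OF p] eq by auto
    qed
    have GH: "ptime ?F ?i (\<lambda>p. enc_cgraph (fst (fst p)))" "ptime ?F ?i (\<lambda>p. enc_cgraph (snd (fst p)))"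
      using ptime_left[OF inp] ptime_right[OF inp] by (simp_all add: input_def)
    \<comment> \<open>Both inputs occur in the list, so the table lists their children and one last
      comparison answers the question.\<close>
    show "ptime ?F ?i (\<lambda>p. enc_bool (isomorphic (fst (fst p)) (snd (fst p))))"
    proof (rule ptime_isomorphic[OF GH(1) _ GH(2) _ T])
      fix p assume p: "p \<in> ?F"
      show "fst (fst p) \<in> colored C" "snd (fst p) \<in> colored C" "valid_table (?T p)"
        using F[OF p] table[OF p] by blast+
      show "set (children (fst (fst p))) \<subseteq> fst ` set (?T p)" "set (children (snd (fst p))) \<subseteq> fst ` set (?T p)"
        using F[OF p] by (blast intro!: sub[OF p])+
    qed
  next
    fix x assume x: "x \<in> ?D"
    then have col: "fst x \<in> colored C" "snd x \<in> colored C" by auto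
    show "([fst x, snd x], []) \<in> states x"
      using col by (auto simp: states_def input_def)
    have "weight (fst x) + weight (snd x) \<le> ((dsize (input x))\<^sup>2 + 1) + ((dsize (input x))\<^sup>2 + 1)"
      by (intro add_mono weight_le colored_simple col) (simp_all add: input_def)
    then show "(\<Sum>G\<leftarrow>fst ([fst x, snd x], []). weight G) \<le> poly [:2, 0, 2:] (dsize (input x))"
      by (simp add: power2_eq_square)
    fix s assume s: "s \<in> states x"
    show "dsize (enc_state x s) \<le> poly (1 + (1 + [:2, 0, 2:] * [:1, 1:]) + (1 + (1 + [:2, 0, 2:] * [:1, 1:]) + [:0, 1:]))
        (dsize (input x))"
      by (rule dsize_enc_state[OF col s])
    assume "left (enc_state x s) \<noteq> Atom"
    then obtain G us vs where "s = (G # us, vs)"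
      by (cases s; cases "fst s") (auto simp: enc_state_def)
    then show "expand s \<in> states x \<and> (\<Sum>G\<leftarrow>fst (expand s). weight G) < (\<Sum>G\<leftarrow>fst s. weight G)"
      using expand_states[of G us vs x] s by (simp add: expand_def)
  qed
  then show ?thesis
    unfolding poly_time_isomorphism_def poly_time_computable_def ptime_def enc_prod_def case_prod_beta input_def
    by simp
qed

end

theorem theorem8:
  fixes C :: "graph set" and \<M> :: decomposition and R :: replacement
  assumes "\<forall>G\<in>C. simple_graph G"
    and "hereditary C"
    and "decomposition_functor C \<M>"
    and "poly_time_decomposition C \<M>"
    and "replacement_operator C \<M> R"
    and "poly_time_replacement C \<M> R"
    and "simple_wrt C \<M> R"
    and "reversible C \<M> R"
    and "poly_time_isomorphism {G \<in> colored C. prime_wrt \<M> G}"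
  shows "poly_time_isomorphism (colored C)"
proof -
  interpret reversible_decomposition C \<M> R
    by unfold_locales (fact assms)+
  show ?thesis by (rule poly_time_isomorphism_colored)
qed

end
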